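(* Consider the problem $\min_{x\in\mathbb{R}^n}F(x)$ with $F(x)=f(x)+R(x)$, $R(x)=\sum_{i=1}^m r_i(x_i)$, where each $r_i$ is a proper closed convex (possibly extended-valued and nondifferentiable) function, $f$ satisfies the Lipschitz conditions with constants $L_f,L_r,L_c$ given in the context, and $F$ is bounded below with a nonempty set of minimizers. Let $\{x^k\}_{k\ge1}$ be generated by the async-parallel block coordinate update with consistent delayed reading described in the context. Assume $S=\mathbb{E}[\mathbf{j}^2]<\infty$ and take the stepsize such that $$0<\eta<\frac{1/L_c}{1+\kappa^2S/(2m)},\qquad\kappa=\frac{L_r}{L_c}.$$ Then any limit point $x^*$ of $\{x^k\}$ is almost surely a critical point of the problem, i.e. $0\in\nabla f(x^* )+\partial R(x^* )$.
   Context: The variable $x=(x_1,\dots,x_m)\in\mathbb{R}^n$ is partitioned into $m$ disjoint blocks; $\nabla_i f$ is the partial gradient with respect to block $i$; $U_i y$ is the vector in $\mathbb{R}^n$ whose $i$-th block is $y_i$ and whose other blocks are zero; $\|\cdot\|$ is the Euclidean norm; $\partial R$ is the convex subdifferential. $f$ is differentiable (possibly nonconvex). Lipschitz conditions: for all $x,y$ and all $i\in\{1,\dots,m\}$, $\|\nabla f(x)-\nabla f(y)\|\le L_f\|x-y\|$, $\|\nabla f(x)-\nabla f(x+U_iy)\|\le L_r\|y_i\|$, $\|\nabla_i f(x)-\nabla_i f(x+U_iy)\|\le L_c\|y_i\|$. The proximal mapping of a convex function $h$ is $\mathbf{prox}_h(y)=\arg\min_x\{h(x)+\frac12\|x-y\|^2\}$.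 Algorithm: given a point $x^0\in\mathbb{R}^n$ and stepsize $\eta>0$, for $k=0,1,2,\dots$ a block index $i_k$ is drawn uniformly at random from $\{1,\dots,m\}$, and $$x^{k+1}_{i_k}=\mathbf{prox}_{\eta r_{i_k}}\big(x^k_{i_k}-\eta\nabla_{i_k}f(x^{k-j_k})\big),\qquad x^{k+1}_i=x^k_i\ \text{ for } i\ne i_k,$$ with the convention $x^k=x^0$ for $k<0$. Each delay $j_k$ is distributed as a fixed random variable $\mathbf{j}$ with $\mathrm{Prob}(\mathbf{j}=t)=q_t$, $t=0,1,2,\dots$ (possibly unbounded). The pair $(i_k,j_k)$ has independent components and is independent of the history $(i_0,j_0),\dots,(i_{k-1},j_{k-1})$. *)

theory Defs
  imports "HOL-Probability.Probability"
begin

text \<open>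
  A block decomposition of \<open>\<real>\<^sup>n\<close> is given by a partition of the coordinates into sets
  \<open>B 1, \<dots>, B m\<close>.  The space of the \<open>i\<close>-th block is identified with the
  coordinate subspace \<open>block_space B i\<close>, so the block \<open>x\<^sub>i\<close> and its embedding
  \<open>U\<^sub>i x\<close> are both the vector \<open>blk B i x\<close>, with the same Euclidean norm.
\<close>

definition block_partition :: "(nat \<Rightarrow> 'n set) \<Rightarrow> nat \<Rightarrow> bool" where
  "block_partition B m \<longleftrightarrow>
     (\<forall>i\<in>{1..m}. B i \<noteq> {}) \<and> disjoint_family_on B {1..m} \<and> (\<Union>i\<in>{1..m}. B i) = UNIV"

definition blk :: "(nat \<Rightarrow> 'n set) \<Rightarrow> nat \<Rightarrow> real ^ 'n \<Rightarrow> real ^ 'n" where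
  "blk B i x = (\<chi> c. if c \<in> B i then x $ c else 0)"

definition block_space :: "(nat \<Rightarrow> 'n set) \<Rightarrow> nat \<Rightarrow> (real ^ 'n) set" where
  "block_space B i = range (blk B i)"

definition grad :: "(real ^ 'n::finite \<Rightarrow> real) \<Rightarrow> real ^ 'n \<Rightarrow> real ^ 'n" where
  "grad f x = (THE D. GDERIV f x :> D)"

definition partial_grad ::
  "(nat \<Rightarrow> 'n::finite set) \<Rightarrow> (real ^ 'n \<Rightarrow> real) \<Rightarrow> nat \<Rightarrow> real ^ 'n \<Rightarrow> real ^ 'n" where
  "partial_grad B f i x = blk B i (grad f x)"

definition block_lipschitz ::
  "(nat \<Rightarrow> 'n::finite set) \<Rightarrow> nat \<Rightarrow> (real ^ 'n \<Rightarrow> real) \<Rightarrow> real \<Rightarrow> real \<Rightarrow> real \<Rightarrow> bool" where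
  "block_lipschitz B m f Lf Lr Lc \<longleftrightarrow>
     (\<forall>x y. norm (grad f x - grad f y) \<le> Lf * norm (x - y)) \<and>
     (\<forall>x y. \<forall>i\<in>{1..m}.
        norm (grad f x - grad f (x + blk B i y)) \<le> Lr * norm (blk B i y) \<and>
        norm (partial_grad B f i x - partial_grad B f i (x + blk B i y))
          \<le> Lc * norm (blk B i y))"

text \<open>
  Extended-valued functions on a subspace \<open>V\<close>; values outside \<open>V\<close> are irrelevant.
  Convexity and closedness (lower semicontinuity) are those of the epigraph.
\<close>

definition epi_on :: "'a set \<Rightarrow> ('a \<Rightarrow> ereal) \<Rightarrow> ('a \<times> real) set" where
  "epi_on V h = {(v, t). v \<in> V \<and> h v \<le> ereal t}"

definition proper_closed_convex_on :: "'a::euclidean_space set \<Rightarrow> ('a \<Rightarrow> ereal) \<Rightarrow> bool" where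
  "proper_closed_convex_on V h \<longleftrightarrow>
     (\<forall>v\<in>V. h v \<noteq> -\<infinity>) \<and> (\<exists>v\<in>V. h v \<noteq> \<infinity>) \<and> closed (epi_on V h) \<and> convex (epi_on V h)"

text \<open>The minimizer is unique when \<open>h\<close> is proper, closed and convex on the subspace \<open>V\<close>.\<close>

definition prox :: "'a::euclidean_space set \<Rightarrow> ('a \<Rightarrow> ereal) \<Rightarrow> 'a \<Rightarrow> 'a" where
  "prox V h y = arg_min_on (\<lambda>v. h v + ereal (1 / 2 * (norm (v - y))\<^sup>2)) V"

text \<open>For proper \<open>h\<close> this is empty at points where \<open>h\<close> is infinite.\<close>

definition subdifferential :: "('a::euclidean_space \<Rightarrow> ereal) \<Rightarrow> 'a \<Rightarrow> 'a set" where
  "subdifferential h x = {g. \<forall>y. h x + ereal (g \<bullet> (y - x)) \<le> h y}"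

definition block_sum ::
  "(nat \<Rightarrow> 'n set) \<Rightarrow> nat \<Rightarrow> (nat \<Rightarrow> real ^ 'n \<Rightarrow> ereal) \<Rightarrow> real ^ 'n \<Rightarrow> ereal" where
  "block_sum B m r x = (\<Sum>i=1..m. r i (blk B i x))"

text \<open>
  One run of the iteration, with block indices \<open>I\<close> and delays \<open>J\<close>.  The truncated
  subtraction \<open>k - J k\<close> implements the convention that iterates with negative index are
  the starting point.
\<close>

definition async_bcu ::
  "(nat \<Rightarrow> 'n::finite set) \<Rightarrow> nat \<Rightarrow> (real ^ 'n \<Rightarrow> real) \<Rightarrow> (nat \<Rightarrow> real ^ 'n \<Rightarrow> ereal) \<Rightarrow>
   real \<Rightarrow> real ^ 'n \<Rightarrow> (nat \<Rightarrow> nat) \<Rightarrow> (nat \<Rightarrow> nat) \<Rightarrow> (nat \<Rightarrow> real ^ 'n) \<Rightarrow> bool" where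
  "async_bcu B m f r \<eta> x0 I J X \<longleftrightarrow>
     X 0 = x0 \<and>
     (\<forall>k.
        blk B (I k) (X (Suc k)) =
          prox (block_space B (I k)) (\<lambda>v. ereal \<eta> * r (I k) v)
            (blk B (I k) (X k) - \<eta> *\<^sub>R partial_grad B f (I k) (X (k - J k))) \<and>
        (\<forall>i\<in>{1..m}. i \<noteq> I k \<longrightarrow> blk B i (X (Suc k)) = blk B i (X k)))"

text \<open>
  Independence of two random variables through the generated \<open>\<sigma>\<close>-algebras; unlike
  \<open>indep_var\<close>, the two codomain types may differ.
\<close>

definition indep_rv ::
  "'w measure \<Rightarrow> 'a measure \<Rightarrow> ('w \<Rightarrow> 'a) \<Rightarrow> 'b measure \<Rightarrow> ('w \<Rightarrow> 'b) \<Rightarrow> bool" where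
  "indep_rv M N X K Y \<longleftrightarrow>
     X \<in> measurable M N \<and> Y \<in> measurable M K \<and>
     prob_space.indep_set M (sets (vimage_algebra (space M) X N))
       (sets (vimage_algebra (space M) Y K))"

end

theory Submission
  imports Defs
begin

text \<open>
  The objective decreases in expectation, up to an error caused by the delay, and the condition
  on \<open>\<eta>\<close> says that the decrease outweighs that error.

  For the step \<open>d\<^sub>k = x\<^sub>k\<^sub>+\<^sub>1 - x\<^sub>k\<close>, the variational inequality of the proximal mapping and
  the quadratic upper bound for \<open>f\<close> along a block give
  \<open>F(x\<^sub>k\<^sub>+\<^sub>1) + (1/\<eta> - Lc) |d\<^sub>k|\<^sup>2 \<le> F(x\<^sub>k) + e\<^sub>k / (2 Lc)\<close>, where \<open>e\<^sub>k\<close> is the squared norm of the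
  drawn block of the difference between the current and the delayed gradient
  (\<open>energy_descent\<close>).  The block is drawn uniformly and independently of the delay and of the
  past, so averaging over it replaces \<open>e\<^sub>k\<close> by \<open>1/m\<close> times the full squared gradient
  difference, which for delay \<open>t\<close> is at most \<open>Lr\<^sup>2 t\<close> times the sum of the last \<open>t\<close> squared
  steps (\<open>expected_sq_delay_le\<close>).  In the sum over all \<open>k\<close> each squared step occurs in at most
  \<open>t\<close> such windows, so averaging over the delay produces \<open>E[j\<^sup>2] = S\<close>.  The total error is thus
  at most \<open>Lr\<^sup>2 S / (2 m Lc) \<Sum>\<^sub>k E|d\<^sub>k|\<^sup>2\<close>, plus a finite contribution from the start, and it is
  absorbed on the left.  Hence \<open>\<Sum>\<^sub>k E|d\<^sub>k|\<^sup>2\<close> converges (\<open>expected_sq_step_summable\<close>).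

  The objective may be infinite at the starting point.  Therefore all expectations are
  restricted to the event that the objective is finite at \<open>x\<^sub>N\<close>.  Almost surely one of these
  events occurs, because a block has a finite term in the objective from its first update
  onwards and every block is drawn eventually.  The expectations are finite because the delayed
  index is cut off at \<open>0\<close>, so that each \<open>x\<^sub>k\<close> has a finite range.

  Conditioning on the past once more, \<open>E|d\<^sub>k|\<^sup>2\<close> is the expected average, over all blocks \<open>a\<close> and delays
  \<open>t\<close>, of the squared candidate steps that \<open>x\<^sub>k\<close> would make with \<open>a\<close> and \<open>t\<close>.  So for one fixed
  delay \<open>t\<close> of positive probability the candidate steps of all blocks tend to zero almost
  surely (\<open>AE_candidate_tendsto_zero\<close>), and so does \<open>x\<^sub>k - x\<^sub>k\<^sub>-\<^sub>t\<close>.  Along a convergent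
  subsequence the variational inequalities pass to the limit because the epigraphs are closed,
  and their sum over the blocks is the criticality condition (\<open>limit_is_critical\<close>).
\<close>

section \<open>The proximal mapping of a proper closed convex function\<close>

text \<open>
  Separating a point strictly below the graph from the epigraph yields a non-vertical
  hyperplane, because the graph point above it lies on the other side.
\<close>

lemma closed_convex_affine_minorant:
  fixes h :: "'a::euclidean_space \<Rightarrow> ereal"
  assumes "proper_closed_convex_on V h"
  obtains a :: 'a and b :: real where "\<And>v t. (v, t) \<in> epi_on V h \<Longrightarrow> a \<bullet> v + b \<le> t"
proof -
  obtain v0 where v0: "v0 \<in> V" "h v0 \<noteq> \<infinity>" "h v0 \<noteq> -\<infinity>"
    using assms by (auto simp: proper_closed_convex_on_def)
  then obtain t0 where t0: "h v0 = ereal t0" by (cases "h v0") auto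
  have cl: "closed (epi_on V h)" and cv: "convex (epi_on V h)"
    using assms by (auto simp: proper_closed_convex_on_def)
  have "(v0, t0 - 1) \<notin> epi_on V h"
    by (auto simp: epi_on_def t0)
  from separating_hyperplane_closed_point[OF cv cl this]
  obtain n \<beta> where n: "n \<bullet> (v0, t0 - 1) < \<beta>" "\<And>z. z \<in> epi_on V h \<Longrightarrow> \<beta> < n \<bullet> z"
    by blast
  obtain n1 n2 where nn: "n = (n1, n2)" by (cases n)
  have "(v0, t0) \<in> epi_on V h" using v0 t0 by (auto simp: epi_on_def)
  from n(2)[OF this] n(1) have pos: "n2 > 0"
    by (simp add: nn algebra_simps)
  show thesis
  proof (rule that[of "- (n1 /\<^sub>R n2)" "\<beta> / n2"])
    fix v t assume "(v, t) \<in> epi_on V h"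
    from n(2)[OF this] have "\<beta> < n1 \<bullet> v + n2 * t" by (simp add: nn)
    then show "- (n1 /\<^sub>R n2) \<bullet> v + \<beta> / n2 \<le> t"
      using pos by (simp add: field_simps)
  qed
qed

text \<open>
  The affine minorant makes the sublevel sets of the regularized function on the closed
  epigraph compact, so a minimum is attained there.  Working on the epigraph replaces an
  extended-valued lower semicontinuous function by a continuous real one.
\<close>
lemma prox_minimizes:
  fixes h :: "'a::euclidean_space \<Rightarrow> ereal"
  assumes pcc: "proper_closed_convex_on V h"
  shows "prox V h y \<in> V"
    and "v \<in> V \<Longrightarrow> h (prox V h y) + ereal (1/2 * (norm (prox V h y - y))\<^sup>2)
            \<le> h v + ereal (1/2 * (norm (v - y))\<^sup>2)"
proof -
  obtain v0 where v0: "v0 \<in> V" "h v0 \<noteq> \<infinity>" "h v0 \<noteq> -\<infinity>"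
    using pcc by (auto simp: proper_closed_convex_on_def)
  then obtain t0 where t0: "h v0 = ereal t0" by (cases "h v0") auto
  obtain a b where ab: "\<And>v t. (v, t) \<in> epi_on V h \<Longrightarrow> a \<bullet> v + b \<le> t"
    using closed_convex_affine_minorant[OF pcc] by blast
  define g where "g = (\<lambda>(v::'a, t::real). t + 1/2 * (norm (v - y))\<^sup>2)"
  define c where "c = g (v0, t0)"
  define K where "K = epi_on V h \<inter> {z. g z \<le> c}"
  have g_cont: "continuous_on T g" for T
    unfolding g_def case_prod_beta by (intro continuous_intros)
  have "closed K"
    unfolding K_def using pcc
    by (intro closed_Int closed_Collect_le[OF g_cont continuous_on_const]) (simp add: proper_closed_convex_on_def)
  moreover have "bounded K"
  proof -
    \<comment> \<open>Completing the square in \<open>a \<bullet> v + b + \<bar>v - y\<bar>\<^sup>2 / 2 \<le> c\<close> bounds \<open>v - y + a\<close>.\<close>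
    define \<rho> where "\<rho> = 2 * (c - b - a \<bullet> y) + (norm a)\<^sup>2"
    have vb: "norm v \<le> norm (y - a) + sqrt \<rho>" and tb: "\<bar>t\<bar> \<le> \<bar>c\<bar> + (norm a * (norm (y - a) + sqrt \<rho>) + \<bar>b\<bar>)"
      if vt: "(v, t) \<in> K" for v t
    proof -
      have le: "a \<bullet> v + b \<le> t" "t + 1/2 * (norm (v - y))\<^sup>2 \<le> c"
        using vt ab by (auto simp: K_def g_def)
      have "(norm (v - (y - a)))\<^sup>2 = (norm (v - y))\<^sup>2 + 2 * (a \<bullet> v) - 2 * (a \<bullet> y) + (norm a)\<^sup>2"
        by (simp add: power2_norm_eq_inner algebra_simps inner_commute)
      also have "\<dots> \<le> \<rho>" using le by (simp add: \<rho>_def)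
      finally have "norm (v - (y - a)) \<le> sqrt \<rho>" by (simp add: real_le_rsqrt)
      then show vb: "norm v \<le> norm (y - a) + sqrt \<rho>"
        using norm_triangle_sub[of v "y - a"] by linarith
      have "\<bar>a \<bullet> v\<bar> \<le> norm a * norm v" by (rule Cauchy_Schwarz_ineq2)
      also have "\<dots> \<le> norm a * (norm (y - a) + sqrt \<rho>)" by (intro mult_left_mono vb) auto
      finally have "\<bar>a \<bullet> v\<bar> \<le> norm a * (norm (y - a) + sqrt \<rho>)" .
      moreover have "t \<le> c" using le(2) zero_le_power2[of "norm (v - y)"] by linarith
      ultimately show "\<bar>t\<bar> \<le> \<bar>c\<bar> + (norm a * (norm (y - a) + sqrt \<rho>) + \<bar>b\<bar>)"
        using le(1) by linarith
    qed
    have "K \<subseteq> cball 0 (norm (y - a) + sqrt \<rho>) \<times> cball 0 (\<bar>c\<bar> + (norm a * (norm (y - a) + sqrt \<rho>) + \<bar>b\<bar>))"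
    proof
      fix z assume "z \<in> K"
      then show "z \<in> cball 0 (norm (y - a) + sqrt \<rho>) \<times> cball 0 (\<bar>c\<bar> + (norm a * (norm (y - a) + sqrt \<rho>) + \<bar>b\<bar>))"
        using vb[of "fst z" "snd z"] tb[of "fst z" "snd z"] by (cases z) auto
    qed
    then show ?thesis by (rule bounded_subset[OF bounded_Times[OF bounded_cball bounded_cball]])
  qed
  ultimately have "compact K" by (simp add: compact_eq_bounded_closed)
  moreover have z0: "(v0, t0) \<in> K" using v0 t0 by (auto simp: K_def epi_on_def c_def)
  ultimately obtain z where z: "z \<in> K" "\<And>w. w \<in> K \<Longrightarrow> g z \<le> g w"
    using continuous_attains_inf[OF _ _ g_cont, of K] by blast
  have zmin: "g z \<le> g w" if "w \<in> epi_on V h" for w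
  proof (cases "g w \<le> c")
    case True then show ?thesis using z(2)[of w] that by (simp add: K_def)
  next
    case False then show ?thesis using z(2)[OF z0] by (simp add: c_def)
  qed
  obtain p s where ps: "z = (p, s)" by (cases z)
  have pV: "p \<in> V" and hp: "h p \<le> ereal s" using z(1) ps by (auto simp: K_def epi_on_def)
  let ?\<phi> = "\<lambda>v. h v + ereal (1/2 * (norm (v - y))\<^sup>2)"
  have pmin: "?\<phi> p \<le> ?\<phi> v" if "v \<in> V" for v
  proof (cases "h v")
    case (real t)
    then have "g z \<le> g (v, t)" using that by (intro zmin) (simp add: epi_on_def)
    moreover have "?\<phi> p \<le> ereal (g z)"
    proof -
      have "?\<phi> p \<le> ereal s + ereal (1/2 * (norm (p - y))\<^sup>2)"
        by (intro add_right_mono hp)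
      then show ?thesis by (simp add: g_def ps)
    qed
    ultimately have "?\<phi> p \<le> ereal (g (v, t))" using order_trans by fastforce
    then show ?thesis using real by (simp add: g_def)
  next
    case PInf then show ?thesis by simp
  next
    case MInf then show ?thesis using that pcc by (auto simp: proper_closed_convex_on_def)
  qed
  have "is_arg_min ?\<phi> (\<lambda>v. v \<in> V) (prox V h y)"
    unfolding prox_def arg_min_on_def arg_min_def
    by (rule someI[of _ p]) (use pV pmin in \<open>auto simp: is_arg_min_def not_less\<close>)
  then show "prox V h y \<in> V" and "v \<in> V \<Longrightarrow> ?\<phi> (prox V h y) \<le> ?\<phi> v"
    by (auto simp: is_arg_min_def not_less)
qed

lemma prox_finite:
  fixes h :: "'a::euclidean_space \<Rightarrow> ereal"
  assumes pcc: "proper_closed_convex_on V h"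
  shows "\<bar>h (prox V h y)\<bar> \<noteq> \<infinity>"
proof -
  obtain v0 where v0: "v0 \<in> V" "h v0 \<noteq> \<infinity>"
    using pcc by (auto simp: proper_closed_convex_on_def)
  have "h (prox V h y) \<noteq> \<infinity>"
    using prox_minimizes(2)[OF pcc v0(1), of y] v0(2) by auto
  moreover have "h (prox V h y) \<noteq> -\<infinity>"
    using pcc prox_minimizes(1)[OF pcc] by (auto simp: proper_closed_convex_on_def)
  ultimately show ?thesis by auto
qed

text \<open>
  First-order optimality: comparing the minimizer \<open>p\<close> with \<open>p + s (v - p)\<close> and dividing by
  \<open>s\<close> leaves an error of order \<open>s\<close>, which vanishes as \<open>s\<close> tends to zero.
\<close>
lemma prox_variational:
  fixes h :: "'a::euclidean_space \<Rightarrow> ereal"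
  assumes pcc: "proper_closed_convex_on V h" and v: "v \<in> V"
  shows "h (prox V h y) + ereal ((y - prox V h y) \<bullet> (v - prox V h y)) \<le> h v"
proof (cases "h v")
  case (real tv)
  define p where "p = prox V h y"
  obtain tp where tp: "h p = ereal tp" using prox_finite[OF pcc, of y] by (auto simp: p_def)
  have pV: "p \<in> V" using prox_minimizes(1)[OF pcc] by (simp add: p_def)
  have key: "tp \<le> tv - (y - p) \<bullet> (v - p) + s / 2 * (norm (v - p))\<^sup>2" if s: "0 < s" "s \<le> 1" for s
  proof -
    define w where "w = (1 - s) *\<^sub>R p + s *\<^sub>R v"
    have "(1 - s) *\<^sub>R (p, tp) + s *\<^sub>R (v, tv) \<in> epi_on V h"
      using pcc s pV v tp real
      by (intro convexD) (auto simp: proper_closed_convex_on_def epi_on_def)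
    then have w: "w \<in> V" "h w \<le> ereal ((1 - s) * tp + s * tv)"
      by (auto simp: epi_on_def w_def)
    have "h p + ereal (1/2 * (norm (p - y))\<^sup>2) \<le> h w + ereal (1/2 * (norm (w - y))\<^sup>2)"
      using prox_minimizes(2)[OF pcc w(1), of y] by (simp add: p_def)
    also have "\<dots> \<le> ereal ((1 - s) * tp + s * tv) + ereal (1/2 * (norm (w - y))\<^sup>2)"
      by (intro add_right_mono w)
    finally have "tp + 1/2 * (norm (p - y))\<^sup>2 \<le> (1 - s) * tp + s * tv + 1/2 * (norm (w - y))\<^sup>2"
      by (simp add: tp)
    moreover have "w - y = (p - y) + s *\<^sub>R (v - p)" by (simp add: w_def algebra_simps)
    then have "(norm (w - y))\<^sup>2 = ((p - y) + s *\<^sub>R (v - p)) \<bullet> ((p - y) + s *\<^sub>R (v - p))"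
      by (simp only: power2_norm_eq_inner)
    then have "(norm (w - y))\<^sup>2 = (norm (p - y))\<^sup>2 - 2 * s * ((y - p) \<bullet> (v - p)) + s * s * (norm (v - p))\<^sup>2"
      by (simp add: power2_norm_eq_inner algebra_simps inner_commute)
    ultimately have "s * tp \<le> s * (tv - (y - p) \<bullet> (v - p) + s / 2 * (norm (v - p))\<^sup>2)"
      by (simp add: algebra_simps)
    then show ?thesis using s by simp
  qed
  have "((\<lambda>s. tv - (y - p) \<bullet> (v - p) + s / 2 * (norm (v - p))\<^sup>2) \<longlongrightarrow> tv - (y - p) \<bullet> (v - p) + 0 / 2 * (norm (v - p))\<^sup>2) (at_right 0)"
    by (intro tendsto_intros) simp
  then have "tp \<le> tv - (y - p) \<bullet> (v - p) + 0 / 2 * (norm (v - p))\<^sup>2"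
  proof (rule tendsto_lowerbound)
    show "\<forall>\<^sub>F s in at_right 0. tp \<le> tv - (y - p) \<bullet> (v - p) + s / 2 * (norm (v - p))\<^sup>2"
      unfolding eventually_at_right_field by (rule exI[of _ 1]) (use key in auto)
  qed simp
  then show ?thesis using real tp by (simp add: p_def)
next
  case PInf then show ?thesis by simp
next
  case MInf then show ?thesis using v pcc by (auto simp: proper_closed_convex_on_def)
qed

text \<open>
  The graph of the subdifferential is closed: for finite \<open>h v\<close> the inequality says that
  the points \<open>(prox V h (y n), h v - (y n - prox V h (y n)) \<bullet> (v - prox V h (y n)))\<close> lie
  in the closed epigraph, and so does their limit.
\<close>
lemma prox_limit_variational:
  fixes h :: "'a::euclidean_space \<Rightarrow> ereal"
  assumes pcc: "proper_closed_convex_on V h"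
    and y: "y \<longlonglongrightarrow> y'" and p: "(\<lambda>n. prox V h (y n)) \<longlonglongrightarrow> p'" and v: "v \<in> V"
  shows "h p' + ereal ((y' - p') \<bullet> (v - p')) \<le> h v"
proof (cases "h v")
  case (real tv)
  let ?p = "\<lambda>n. prox V h (y n)"
  have mem: "\<And>n. (?p n, tv - (y n - ?p n) \<bullet> (v - ?p n)) \<in> epi_on V h"
    subgoal for n
      using prox_variational[OF pcc v, of "y n"] prox_minimizes(1)[OF pcc, of "y n"]
        prox_finite[OF pcc, of "y n"]
      by (cases "h (?p n)") (auto simp: epi_on_def real)
    done
  have lim: "(\<lambda>n. (?p n, tv - (y n - ?p n) \<bullet> (v - ?p n))) \<longlonglongrightarrow> (p', tv - (y' - p') \<bullet> (v - p'))"
    by (intro tendsto_intros y p)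
  have "closed (epi_on V h)" using pcc by (auto simp: proper_closed_convex_on_def)
  from closed_sequentially[OF this mem lim]
  have "(p', tv - (y' - p') \<bullet> (v - p')) \<in> epi_on V h" .
  then show ?thesis by (cases "h p'") (auto simp: epi_on_def real)
next
  case PInf then show ?thesis by simp
next
  case MInf then show ?thesis using v pcc by (auto simp: proper_closed_convex_on_def)
qed

lemma proper_closed_convex_on_scale:
  fixes h :: "'a::euclidean_space \<Rightarrow> ereal"
  assumes pcc: "proper_closed_convex_on V h" and c: "0 < c"
  shows "proper_closed_convex_on V (\<lambda>v. ereal c * h v)"
proof -
  have "ereal c * h v \<le> ereal t \<longleftrightarrow> h v \<le> ereal (t / c)" for v t
    using c by (cases "h v") (auto simp: field_simps)
  then have eq: "epi_on V (\<lambda>v. ereal c * h v) = (\<lambda>z. (fst z, snd z / c)) -` epi_on V h"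
    by (auto simp: epi_on_def)
  have "linear (\<lambda>z::'a \<times> real. (fst z, snd z / c))"
    by (rule linearI) (auto simp: add_divide_distrib)
  then have "convex (epi_on V (\<lambda>v. ereal c * h v))"
    unfolding eq using pcc by (intro convex_linear_vimage) (auto simp: proper_closed_convex_on_def)
  moreover have "closed (epi_on V (\<lambda>v. ereal c * h v))"
  proof -
    have "continuous_on UNIV (\<lambda>z::'a \<times> real. (fst z, snd z / c))"
      using c by (intro continuous_intros) auto
    then show ?thesis
      unfolding eq using pcc by (intro closed_vimage) (auto simp: proper_closed_convex_on_def)
  qed
  moreover have "\<forall>v\<in>V. ereal c * h v \<noteq> -\<infinity>" "\<exists>v\<in>V. ereal c * h v \<noteq> \<infinity>"
    using pcc c by (auto simp: proper_closed_convex_on_def ereal_mult_eq_MInfty ereal_mult_eq_PInfty)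
  ultimately show ?thesis by (simp add: proper_closed_convex_on_def)
qed

section \<open>Block decomposition of Euclidean space\<close>
lemma blk_nth [simp]: "blk B a v $ c = (if c \<in> B a then v $ c else 0)"
  by (simp add: blk_def)

lemma blk_add: "blk B a (u + v) = blk B a u + blk B a v"
  and blk_diff: "blk B a (u - v) = blk B a u - blk B a v"
  and blk_scaleR: "blk B a (c *\<^sub>R v) = c *\<^sub>R blk B a v"
  and blk_blk: "blk B a (blk B a v) = blk B a v"
  by (simp_all add: vec_eq_iff)

lemma blk_in_block_space [simp]: "blk B a v \<in> block_space B a"
  by (simp add: block_space_def)

lemma blk_of_block_space: "v \<in> block_space B a \<Longrightarrow> blk B a v = v"
  by (auto simp: block_space_def blk_blk)

lemma inner_blk_left: "blk B a u \<bullet> v = blk B a u \<bullet> blk B a v"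
  by (auto simp: inner_vec_def intro!: sum.cong)

lemma tendsto_blk:
  assumes "(u \<longlongrightarrow> l) G" shows "((\<lambda>n. blk B a (u n)) \<longlongrightarrow> blk B a l) G"
proof (rule vec_tendstoI)
  fix c show "((\<lambda>n. blk B a (u n) $ c) \<longlongrightarrow> blk B a l $ c) G"
    using tendsto_vec_nth[OF assms, of c] by (cases "c \<in> B a") auto
qed

lemma block_partition_index:
  assumes "block_partition B m"
  obtains a where "a \<in> {1..m}" "c \<in> B a" "\<And>b. b \<in> {1..m} \<Longrightarrow> c \<in> B b \<longleftrightarrow> b = a"
proof -
  have "c \<in> (\<Union>a\<in>{1..m}. B a)" using assms by (simp add: block_partition_def)
  then obtain a where a: "a \<in> {1..m}" "c \<in> B a" by blast
  moreover have "disjoint_family_on B {1..m}" using assms by (simp add: block_partition_def)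
  ultimately have "c \<in> B b \<longleftrightarrow> b = a" if "b \<in> {1..m}" for b
    using that unfolding disjoint_family_on_def by blast
  with a that show thesis by blast
qed

lemma block_partition_pos:
  assumes "block_partition (B :: nat \<Rightarrow> 'n::finite set) m" shows "0 < m"
proof -
  obtain a where "a \<in> {1..m}" using block_partition_index[OF assms, of undefined] by blast
  then show ?thesis by simp
qed

lemma sum_over_block_of_coordinate:
  fixes z :: real
  assumes "block_partition B m"
  shows "(\<Sum>a=1..m. if c \<in> B a then z else 0) = z"
proof -
  obtain a where a: "a \<in> {1..m}" "\<And>b. b \<in> {1..m} \<Longrightarrow> c \<in> B b \<longleftrightarrow> b = a"
    using block_partition_index[OF assms, of c] by metis
  have "(\<Sum>b=1..m. if c \<in> B b then z else 0) = (\<Sum>b=1..m. if b = a then z else 0)"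
    by (intro sum.cong refl) (simp add: a)
  then show ?thesis using a(1) by simp
qed

lemma sum_norm_blk:
  assumes "block_partition B m"
  shows "(\<Sum>a=1..m. (norm (blk B a v))\<^sup>2) = (norm v)\<^sup>2"
proof -
  have "(\<Sum>a=1..m. (norm (blk B a v))\<^sup>2) = (\<Sum>a=1..m. \<Sum>c\<in>UNIV. if c \<in> B a then (v $ c)\<^sup>2 else 0)"
    unfolding power2_norm_eq_inner inner_vec_def
    by (intro sum.cong refl) (simp add: power2_eq_square)
  also have "\<dots> = (\<Sum>c\<in>UNIV. (v $ c)\<^sup>2)"
    by (subst sum.swap) (simp add: sum_over_block_of_coordinate[OF assms] del: One_nat_def)
  also have "\<dots> = (norm v)\<^sup>2"
    unfolding power2_norm_eq_inner inner_vec_def by (simp add: power2_eq_square)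
  finally show ?thesis .
qed

lemma sum_inner_blk:
  assumes "block_partition B m"
  shows "(\<Sum>a=1..m. blk B a u \<bullet> blk B a v) = u \<bullet> v"
proof -
  have "(\<Sum>a=1..m. blk B a u \<bullet> blk B a v) = (\<Sum>a=1..m. \<Sum>c\<in>UNIV. if c \<in> B a then u $ c * v $ c else 0)"
    unfolding inner_vec_def by (intro sum.cong refl) simp
  also have "\<dots> = u \<bullet> v"
    by (subst sum.swap) (simp add: sum_over_block_of_coordinate[OF assms] inner_vec_def del: One_nat_def)
  finally show ?thesis .
qed

lemma eq_if_blk_eq:
  assumes "block_partition B m" and "\<And>a. a \<in> {1..m} \<Longrightarrow> blk B a u = blk B a v"
  shows "u = v"
proof -
  have "u $ c = v $ c" for c
  proof -
    obtain a where a: "a \<in> {1..m}" "c \<in> B a"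
      using block_partition_index[OF assms(1), of c] by blast
    with assms(2)[of a] have "blk B a u $ c = blk B a v $ c" by simp
    with a show ?thesis by simp
  qed
  then show ?thesis by (simp add: vec_eq_iff)
qed

lemma blk_blk_other:
  assumes "block_partition B m" "a \<in> {1..m}" "b \<in> {1..m}" "a \<noteq> b"
  shows "blk B b (blk B a v) = 0"
proof -
  have "B a \<inter> B b = {}"
    using assms by (auto simp: block_partition_def disjoint_family_on_def simp del: One_nat_def)
  then show ?thesis by (auto simp: vec_eq_iff)
qed

section \<open>Gradients and the quadratic upper bound\<close>
lemma GDERIV_grad:
  fixes f :: "real ^ 'n::finite \<Rightarrow> real"
  assumes "f differentiable (at x)"
  shows "GDERIV f x :> grad f x"
proof -
  obtain f' where f': "(f has_derivative f') (at x)"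
    using assms by (auto simp: differentiable_def)
  then have "linear f'" by (rule has_derivative_linear)
  then have "f' = (\<lambda>h. h \<bullet> adjoint f' 1)"
    using adjoint_works[of f' _ "1 :: real"] by (simp add: fun_eq_iff)
  with f' have D: "GDERIV f x :> adjoint f' 1" by (simp add: gderiv_def)
  have uniq: "D = adjoint f' 1" if "GDERIV f x :> D" for D
  proof -
    have "(\<lambda>h. h \<bullet> D) = (\<lambda>h. h \<bullet> adjoint f' 1)"
      by (rule has_derivative_unique[OF that[unfolded gderiv_def] D[unfolded gderiv_def]])
    then have "\<forall>h. h \<bullet> D = h \<bullet> adjoint f' 1" by (simp add: fun_eq_iff)
    then show ?thesis using vector_eq_ldot[of D "adjoint f' 1"] by blast
  qed
  show ?thesis unfolding grad_def by (rule theI[of "\<lambda>D. GDERIV f x :> D", OF D uniq])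
qed

text \<open>
  The difference of the two sides, as a function of the position on the segment, has a
  nonpositive derivative.
\<close>
lemma quadratic_upper_bound_along_segment:
  fixes f :: "'a::real_inner \<Rightarrow> real"
  assumes f: "\<And>y. GDERIV f y :> g y"
    and lip: "\<And>s. 0 \<le> s \<Longrightarrow> (g (x + s *\<^sub>R d) - g x) \<bullet> d \<le> L * s * (norm d)\<^sup>2"
  shows "f (x + d) \<le> f x + g x \<bullet> d + L / 2 * (norm d)\<^sup>2"
proof -
  let ?\<phi> = "\<lambda>s. f (x + s *\<^sub>R d) - s * (g x \<bullet> d) - L / 2 * s\<^sup>2 * (norm d)\<^sup>2"
  have "(?\<phi> has_real_derivative ((g (x + s *\<^sub>R d) - g x) \<bullet> d - L * s * (norm d)\<^sup>2)) (at s)" for s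
  proof -
    have "((\<lambda>s. x + s *\<^sub>R d) has_derivative (\<lambda>h. h *\<^sub>R d)) (at s)"
      by (auto intro!: derivative_eq_intros)
    from has_derivative_compose[OF this f[unfolded gderiv_def]]
    have "((\<lambda>s. f (x + s *\<^sub>R d)) has_real_derivative g (x + s *\<^sub>R d) \<bullet> d) (at s)"
      by (simp add: has_field_derivative_def inner_commute mult_commute_abs)
    then show ?thesis
      by (auto intro!: derivative_eq_intros simp: inner_diff_left)
  qed
  then have "?\<phi> 1 \<le> ?\<phi> 0"
    by (intro DERIV_nonpos_imp_nonincreasing[of 0 1 ?\<phi>]) (use lip in \<open>force\<close>)+
  then show ?thesis by simp
qed

section \<open>The deterministic effect of one block update\<close>
locale composite_problem =
  fixes B :: "nat \<Rightarrow> 'n::finite set" and m :: nat and f :: "real ^ 'n \<Rightarrow> real"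
    and r :: "nat \<Rightarrow> real ^ 'n \<Rightarrow> ereal" and Lf Lr Lc \<eta> :: real
  assumes blocks: "block_partition B m"
    and f_diff: "\<And>y. f differentiable (at y)"
    and Lc_pos: "0 < Lc"
    and f_lip: "block_lipschitz B m f Lf Lr Lc"
    and r_pcc: "\<And>l. l \<in> {1..m} \<Longrightarrow> proper_closed_convex_on (block_space B l) (r l)"
    and \<eta>_pos: "0 < \<eta>"
begin

text \<open>
  The gradient is read at \<open>w\<close>, which differs from the base point \<open>u\<close> in the presence of
  a delay.
\<close>
definition prox_grad :: "nat \<Rightarrow> real ^ 'n \<Rightarrow> real ^ 'n \<Rightarrow> real ^ 'n" where
  "prox_grad a u w =
     prox (block_space B a) (\<lambda>v. ereal \<eta> * r a v) (blk B a u - \<eta> *\<^sub>R partial_grad B f a w)"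

definition incr :: "nat \<Rightarrow> real ^ 'n \<Rightarrow> real ^ 'n \<Rightarrow> real ^ 'n" where
  "incr a u w = prox_grad a u w - blk B a u"

text \<open>
  By properness of the block terms, this says that the objective is finite at \<open>u\<close>.
\<close>
definition feasible :: "real ^ 'n \<Rightarrow> bool" where
  "feasible u \<longleftrightarrow> (\<forall>a\<in>{1..m}. r a (blk B a u) \<noteq> \<infinity>)"

text \<open>
  The real value of the objective at a feasible point; elsewhere the infinite block terms
  count as \<open>0\<close>.
\<close>
definition energy :: "real ^ 'n \<Rightarrow> real" where
  "energy u = f u + (\<Sum>a=1..m. real_of_ereal (r a (blk B a u)))"

lemma r_scaled:
  "a \<in> {1..m} \<Longrightarrow> proper_closed_convex_on (block_space B a) (\<lambda>v. ereal \<eta> * r a v)"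
  by (rule proper_closed_convex_on_scale[OF r_pcc \<eta>_pos])

lemma r_not_MInf: "a \<in> {1..m} \<Longrightarrow> v \<in> block_space B a \<Longrightarrow> r a v \<noteq> -\<infinity>"
  using r_pcc[of a] by (auto simp: proper_closed_convex_on_def)

lemma prox_grad_in_block: "a \<in> {1..m} \<Longrightarrow> prox_grad a u w \<in> block_space B a"
  unfolding prox_grad_def by (rule prox_minimizes(1)[OF r_scaled])

lemma r_prox_grad_finite: "a \<in> {1..m} \<Longrightarrow> \<bar>r a (prox_grad a u w)\<bar> \<noteq> \<infinity>"
  using prox_finite[OF r_scaled, of a "blk B a u - \<eta> *\<^sub>R partial_grad B f a w"] \<eta>_pos
  by (cases "r a (prox_grad a u w)") (auto simp: prox_grad_def)

lemma blk_incr: "a \<in> {1..m} \<Longrightarrow> blk B a (incr a u w) = incr a u w"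
  using blk_of_block_space[OF prox_grad_in_block, of a u w] by (simp add: incr_def blk_diff blk_blk)

lemma blk_incr_other:
  "a \<in> {1..m} \<Longrightarrow> b \<in> {1..m} \<Longrightarrow> a \<noteq> b \<Longrightarrow> blk B b (incr a u w) = 0"
  by (metis blk_incr blk_blk_other[OF blocks])

lemma blk_step:
  assumes "a \<in> {1..m}" "b \<in> {1..m}"
  shows "blk B b (u + incr a u w) = (if b = a then prox_grad a u w else blk B b u)"
  using assms blk_incr[of a u w] blk_incr_other[of a b u w] by (auto simp: blk_add incr_def)

lemma async_bcu_step:
  assumes run: "async_bcu B m f r \<eta> x0 I J X" and I: "I k \<in> {1..m}"
  shows "X (Suc k) = X k + incr (I k) (X k) (X (k - J k))"
proof (rule eq_if_blk_eq[OF blocks])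
  fix b assume b: "b \<in> {1..m}"
  have "blk B (I k) (X (Suc k)) = prox_grad (I k) (X k) (X (k - J k))"
    using run by (auto simp: async_bcu_def prox_grad_def)
  moreover have "b \<noteq> I k \<Longrightarrow> blk B b (X (Suc k)) = blk B b (X k)"
    using run b by (auto simp: async_bcu_def)
  ultimately show "blk B b (X (Suc k)) = blk B b (X k + incr (I k) (X k) (X (k - J k)))"
    unfolding blk_step[OF I b] by auto
qed

lemma feasible_step:
  assumes "a \<in> {1..m}" "feasible u" shows "feasible (u + incr a u w)"
  using assms blk_step[OF assms(1)] r_prox_grad_finite[OF assms(1), of u w]
  by (auto simp: feasible_def)

lemma r_real_if_feasible:
  "feasible u \<Longrightarrow> a \<in> {1..m} \<Longrightarrow> r a (blk B a u) = ereal (real_of_ereal (r a (blk B a u)))"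
  using r_not_MInf[of a "blk B a u"] by (cases "r a (blk B a u)") (auto simp: feasible_def)

lemma objective_eq_energy:
  assumes "feasible u" shows "ereal (f u) + block_sum B m r u = ereal (energy u)"
proof -
  have "block_sum B m r u = (\<Sum>a=1..m. ereal (real_of_ereal (r a (blk B a u))))"
    unfolding block_sum_def by (intro sum.cong refl r_real_if_feasible assms)
  then show ?thesis by (simp add: energy_def)
qed

lemma prox_grad_inequality:
  assumes a: "a \<in> {1..m}" and v: "v \<in> block_space B a" and rv: "r a v = ereal t"
  shows "real_of_ereal (r a (prox_grad a u w))
           + (1 / \<eta>) * ((blk B a u - \<eta> *\<^sub>R partial_grad B f a w - prox_grad a u w) \<bullet> (v - prox_grad a u w)) \<le> t"
proof -
  obtain p where p: "r a (prox_grad a u w) = ereal p"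
    using r_prox_grad_finite[OF a, of u w] by auto
  have "\<eta> * p + (blk B a u - \<eta> *\<^sub>R partial_grad B f a w - prox_grad a u w) \<bullet> (v - prox_grad a u w) \<le> \<eta> * t"
    using prox_variational[OF r_scaled[OF a] v, of "blk B a u - \<eta> *\<^sub>R partial_grad B f a w"]
    by (simp add: prox_grad_def[symmetric] p rv)
  then show ?thesis using \<eta>_pos by (simp add: p field_simps)
qed

lemma block_quadratic_upper_bound:
  assumes a: "a \<in> {1..m}" and d: "blk B a d = d"
  shows "f (u + d) \<le> f u + grad f u \<bullet> d + Lc / 2 * (norm d)\<^sup>2"
proof (rule quadratic_upper_bound_along_segment)
  show "GDERIV f y :> grad f y" for y by (rule GDERIV_grad[OF f_diff])
next
  fix s :: real assume s: "0 \<le> s"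
  have "blk B a (s *\<^sub>R d) = s *\<^sub>R d" by (simp add: blk_scaleR d)
  with f_lip a have "norm (blk B a (grad f u) - blk B a (grad f (u + s *\<^sub>R d))) \<le> Lc * norm (s *\<^sub>R d)"
    unfolding block_lipschitz_def partial_grad_def by metis
  then have "norm (blk B a (grad f (u + s *\<^sub>R d) - grad f u)) \<le> Lc * (s * norm d)"
    using s by (simp add: norm_minus_commute blk_diff)
  moreover have "(grad f (u + s *\<^sub>R d) - grad f u) \<bullet> d = blk B a (grad f (u + s *\<^sub>R d) - grad f u) \<bullet> d"
    by (metis d inner_blk_left inner_commute)
  ultimately have "(grad f (u + s *\<^sub>R d) - grad f u) \<bullet> d \<le> Lc * (s * norm d) * norm d"
    by (smt (verit) Cauchy_Schwarz_ineq2 mult_right_mono norm_ge_zero)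
  then show "(grad f (u + s *\<^sub>R d) - grad f u) \<bullet> d \<le> Lc * s * (norm d)\<^sup>2"
    by (simp add: power2_eq_square algebra_simps)
qed

text \<open>
  The variational inequality with comparison point \<open>blk B a u\<close> bounds the change of the block
  term, the quadratic upper bound the change of \<open>f\<close>.  What remains is the inner product of the
  gradient error with the step, which Young's inequality with weight \<open>Lc\<close> splits; that weight
  leaves exactly the coefficient \<open>1 / \<eta> - Lc\<close> of the stepsize condition.
\<close>
lemma energy_descent:
  assumes a: "a \<in> {1..m}" and u: "feasible u"
  shows "energy (u + incr a u w) + (1 / \<eta> - Lc) * (norm (incr a u w))\<^sup>2
           \<le> energy u + 1 / (2 * Lc) * (norm (blk B a (grad f u - grad f w)))\<^sup>2"
proof -
  define d where "d = incr a u w"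
  define g where "g = blk B a (grad f u - grad f w)"
  let ?\<rho> = "\<lambda>v b. real_of_ereal (r b (blk B b v))"
  have d: "blk B a d = d" unfolding d_def by (rule blk_incr[OF a])
  have p: "prox_grad a u w = blk B a u + d" by (simp add: d_def incr_def)
  have "?\<rho> (u + d) a + (1 / \<eta>) * ((blk B a u - \<eta> *\<^sub>R partial_grad B f a w - (blk B a u + d)) \<bullet> (blk B a u - (blk B a u + d))) \<le> ?\<rho> u a"
    using prox_grad_inequality[OF a blk_in_block_space r_real_if_feasible[OF u a], of u w]
      blk_step[OF a a, of u w]
    by (simp add: p d_def)
  then have r: "?\<rho> (u + d) a + grad f w \<bullet> d + 1 / \<eta> * (norm d)\<^sup>2 \<le> ?\<rho> u a"
    using \<eta>_pos inner_blk_left[of B a d "grad f w"]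
    by (simp add: partial_grad_def d power2_norm_eq_inner algebra_simps inner_commute)
  have e: "energy v = f v + (\<Sum>b\<in>{1..m} - {a}. ?\<rho> v b) + ?\<rho> v a" for v
    using a by (simp add: energy_def sum.remove)
  have "(\<Sum>b\<in>{1..m} - {a}. ?\<rho> (u + d) b) = (\<Sum>b\<in>{1..m} - {a}. ?\<rho> u b)"
    using blk_step[OF a, of _ u w] by (intro sum.cong refl) (auto simp: d_def)
  then have "energy (u + d) - energy u = f (u + d) - f u + (?\<rho> (u + d) a - ?\<rho> u a)"
    by (simp add: e)
  also have "\<dots> \<le> (grad f u - grad f w) \<bullet> d + (Lc / 2 - 1 / \<eta>) * (norm d)\<^sup>2"
    using block_quadratic_upper_bound[OF a d, of u] r by (simp add: algebra_simps)
  also have "(grad f u - grad f w) \<bullet> d = g \<bullet> d"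
    unfolding g_def by (metis d inner_blk_left inner_commute)
  also have "g \<bullet> d \<le> 1 / (2 * Lc) * (norm g)\<^sup>2 + Lc / 2 * (norm d)\<^sup>2"
  proof -
    have "0 \<le> (norm (g - Lc *\<^sub>R d))\<^sup>2" by simp
    also have "\<dots> = (norm g)\<^sup>2 - 2 * Lc * (g \<bullet> d) + Lc * Lc * (norm d)\<^sup>2"
      by (simp add: power2_norm_eq_inner algebra_simps inner_commute)
    finally show ?thesis using Lc_pos by (simp add: field_simps power2_eq_square)
  qed
  finally show ?thesis by (simp add: d_def g_def algebra_simps)
qed

text \<open>
  Each iterate differs from its predecessor in one block only, so \<open>Lr\<close> applies to every term
  of the telescoped gradient difference; Cauchy--Schwarz over a window of at most \<open>t\<close> steps
  gives the factor \<open>t\<close>.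
\<close>
lemma delayed_gradient_error:
  assumes step: "\<And>l. l < k \<Longrightarrow> I l \<in> {1..m} \<and> blk B (I l) (X (Suc l) - X l) = X (Suc l) - X l"
  shows "(norm (grad f (X k) - grad f (X (k - t))))\<^sup>2
           \<le> Lr\<^sup>2 * (real t * (\<Sum>l\<in>{k - t..<k}. (norm (X (Suc l) - X l))\<^sup>2))"
proof -
  let ?d = "\<lambda>l. norm (X (Suc l) - X l)"
  have "norm (grad f (X k) - grad f (X (k - t)))
          = norm (\<Sum>l\<in>{k - t..<k}. grad f (X (Suc l)) - grad f (X l))"
    by (subst sum_Suc_diff') auto
  also have "\<dots> \<le> (\<Sum>l\<in>{k - t..<k}. Lr * ?d l)"
  proof (intro sum_norm_le)
    fix l assume "l \<in> {k - t..<k}"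
    then have "I l \<in> {1..m}" "blk B (I l) (X (Suc l) - X l) = X (Suc l) - X l"
      using step[of l] by auto
    with f_lip have "norm (grad f (X l) - grad f (X l + (X (Suc l) - X l))) \<le> Lr * ?d l"
      unfolding block_lipschitz_def by metis
    then show "norm (grad f (X (Suc l)) - grad f (X l)) \<le> Lr * ?d l"
      by (simp add: norm_minus_commute)
  qed
  finally have "(norm (grad f (X k) - grad f (X (k - t))))\<^sup>2 \<le> (Lr * (\<Sum>l\<in>{k - t..<k}. ?d l))\<^sup>2"
    by (intro power_mono) (simp_all add: sum_distrib_left)
  also have "\<dots> = Lr\<^sup>2 * (\<Sum>l\<in>{k - t..<k}. ?d l)\<^sup>2" by (simp add: power_mult_distrib)
  also have "\<dots> \<le> Lr\<^sup>2 * (real t * (\<Sum>l\<in>{k - t..<k}. (?d l)\<^sup>2))"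
  proof (intro mult_left_mono)
    have "(\<Sum>l\<in>{k - t..<k}. ?d l)\<^sup>2 \<le> (\<Sum>l\<in>{k - t..<k}. (?d l)\<^sup>2) * card {k - t..<k}"
      by (rule sum_squared_le_sum_of_squares)
    also have "\<dots> \<le> (\<Sum>l\<in>{k - t..<k}. (?d l)\<^sup>2) * real t"
      by (intro mult_left_mono sum_nonneg) auto
    finally show "(\<Sum>l\<in>{k - t..<k}. ?d l)\<^sup>2 \<le> real t * (\<Sum>l\<in>{k - t..<k}. (?d l)\<^sup>2)"
      by (simp add: mult.commute)
  qed simp
  finally show ?thesis .
qed

text \<open>
  Where the candidate steps vanish, base point and updated block have the same limit, so the
  variational inequality of every block holds at \<open>xs\<close> with multiplier the negative partial
  gradient; the sum over the blocks is the subgradient inequality.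
\<close>
lemma limit_is_critical:
  assumes u: "u \<longlonglongrightarrow> xs" and w: "w \<longlonglongrightarrow> xs"
    and incr: "\<And>a. a \<in> {1..m} \<Longrightarrow> (\<lambda>n. incr a (u n) (w n)) \<longlonglongrightarrow> 0"
  shows "0 \<in> (\<lambda>g. grad f xs + g) ` subdifferential (block_sum B m r) xs"
proof -
  have grad_w: "(\<lambda>n. grad f (w n)) \<longlonglongrightarrow> grad f xs"
  proof -
    have "(\<lambda>n. grad f (w n) - grad f xs) \<longlonglongrightarrow> 0"
    proof (rule Lim_null_comparison)
      show "\<forall>\<^sub>F n in sequentially. norm (grad f (w n) - grad f xs) \<le> Lf * norm (w n - xs)"
        using f_lip by (auto simp: block_lipschitz_def)
      show "(\<lambda>n. Lf * norm (w n - xs)) \<longlonglongrightarrow> 0"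
        using w by (intro tendsto_mult_right_zero tendsto_norm_zero) (simp add: LIM_zero)
    qed
    then show ?thesis by (simp add: LIM_zero_iff)
  qed
  have block: "r a (blk B a xs) + ereal (- blk B a (grad f xs) \<bullet> blk B a (y - xs)) \<le> r a (blk B a y)"
    if a: "a \<in> {1..m}" for a y
  proof -
    let ?y = "\<lambda>n. blk B a (u n) - \<eta> *\<^sub>R partial_grad B f a (w n)"
    have y: "?y \<longlonglongrightarrow> blk B a xs - \<eta> *\<^sub>R blk B a (grad f xs)"
      unfolding partial_grad_def by (intro tendsto_intros tendsto_blk u grad_w)
    have "(\<lambda>n. incr a (u n) (w n) + blk B a (u n)) \<longlonglongrightarrow> 0 + blk B a xs"
      by (intro tendsto_add incr a tendsto_blk u)
    then have p: "(\<lambda>n. prox (block_space B a) (\<lambda>v. ereal \<eta> * r a v) (?y n)) \<longlonglongrightarrow> blk B a xs"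
      by (simp add: incr_def prox_grad_def)
    have "ereal \<eta> * r a (blk B a xs) + ereal (- \<eta> * (blk B a (grad f xs) \<bullet> blk B a (y - xs)))
            \<le> ereal \<eta> * r a (blk B a y)"
      using prox_limit_variational[OF r_scaled[OF a] y p blk_in_block_space[of B a y]]
      by (simp add: blk_diff)
    moreover have "s - z \<le> t" if "\<eta> * s - \<eta> * z \<le> \<eta> * t" for s t z
      using that \<eta>_pos by (simp flip: right_diff_distrib)
    ultimately show ?thesis
      using \<eta>_pos r_not_MInf[OF a blk_in_block_space[of B a xs]]
      by (cases "r a (blk B a xs)"; cases "r a (blk B a y)") auto
  qed
  have "block_sum B m r xs + ereal (- grad f xs \<bullet> (y - xs)) \<le> block_sum B m r y" for y
  proof -
    have "- grad f xs \<bullet> (y - xs) = (\<Sum>a=1..m. - blk B a (grad f xs) \<bullet> blk B a (y - xs))"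
      by (simp add: sum_inner_blk[OF blocks] sum_negf del: One_nat_def)
    then have "block_sum B m r xs + ereal (- grad f xs \<bullet> (y - xs))
        = (\<Sum>a=1..m. r a (blk B a xs) + ereal (- blk B a (grad f xs) \<bullet> blk B a (y - xs)))"
      by (simp add: block_sum_def sum.distrib)
    also have "\<dots> \<le> block_sum B m r y"
      unfolding block_sum_def by (intro sum_mono block) auto
    finally show ?thesis .
  qed
  then have "- grad f xs \<in> subdifferential (block_sum B m r) xs"
    by (simp add: subdifferential_def)
  then show ?thesis by (intro image_eqI[of _ _ "- grad f xs"]) auto
qed

end

section \<open>Uniform block sampling with independent delays\<close>

text \<open>
  For countable codomains every function on the product is measurable, so Fubini's theorem for
  the joint distribution, a product by independence, applies to arbitrary nonnegative \<open>g\<close>.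
\<close>
lemma nn_integral_indep_rv_countable:
  assumes M: "prob_space M" and indep: "indep_rv M (count_space A) X (count_space C) Y"
    and countable: "countable A" "countable C"
  shows "(\<integral>\<^sup>+\<omega>. g (X \<omega>) (Y \<omega>) \<partial>M) = (\<integral>\<^sup>+\<omega>'. \<integral>\<^sup>+\<omega>. g (X \<omega>) (Y \<omega>') \<partial>M \<partial>M)"
proof -
  interpret prob_space M by fact
  have X [measurable]: "X \<in> measurable M (count_space A)"
    and Y [measurable]: "Y \<in> measurable M (count_space C)"
    and indep_set: "indep_set (sets (vimage_algebra (space M) X (count_space A)))
       (sets (vimage_algebra (space M) Y (count_space C)))"
    using indep by (auto simp: indep_rv_def)
  let ?DX = "distr M (count_space A) X" and ?DY = "distr M (count_space C) Y"
  interpret DX: prob_space ?DX by (rule prob_space_distr[OF X])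
  interpret DY: prob_space ?DY by (rule prob_space_distr[OF Y])
  have YX: "(\<lambda>\<omega>. (Y \<omega>, X \<omega>)) \<in> measurable M (count_space C \<Otimes>\<^sub>M count_space A)"
    by measurable
  have joint: "?DY \<Otimes>\<^sub>M ?DX = distr M (count_space C \<Otimes>\<^sub>M count_space A) (\<lambda>\<omega>. (Y \<omega>, X \<omega>))"
  proof (rule pair_measure_eqI)
    show "sigma_finite_measure ?DY" "sigma_finite_measure ?DX" by unfold_locales
    show "sets (?DY \<Otimes>\<^sub>M ?DX) = sets (distr M (count_space C \<Otimes>\<^sub>M count_space A) (\<lambda>\<omega>. (Y \<omega>, X \<omega>)))"
      unfolding sets_distr by (intro sets_pair_measure_cong) simp_all
  next
    fix P Q assume "P \<in> sets ?DY" "Q \<in> sets ?DX"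
    then have P: "P \<subseteq> C" and Q: "Q \<subseteq> A" by auto
    have "Y -` P \<inter> space M \<in> sets (vimage_algebra (space M) Y (count_space C))"
      "X -` Q \<inter> space M \<in> sets (vimage_algebra (space M) X (count_space A))"
      using P Q by (auto intro!: in_vimage_algebra)
    from indep_setD[OF indep_set this(2) this(1)]
    have "prob ((X -` Q \<inter> space M) \<inter> (Y -` P \<inter> space M)) = prob (X -` Q \<inter> space M) * prob (Y -` P \<inter> space M)" .
    moreover have "(\<lambda>\<omega>. (Y \<omega>, X \<omega>)) -` (P \<times> Q) \<inter> space M = (X -` Q \<inter> space M) \<inter> (Y -` P \<inter> space M)"
      by auto
    moreover have "P \<times> Q \<in> sets (count_space C \<Otimes>\<^sub>M count_space A)"
      using P Q by (intro pair_measureI) auto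
    ultimately show "emeasure ?DY P * emeasure ?DX Q
        = emeasure (distr M (count_space C \<Otimes>\<^sub>M count_space A) (\<lambda>\<omega>. (Y \<omega>, X \<omega>))) (P \<times> Q)"
      using P Q YX by (simp add: emeasure_distr emeasure_eq_measure ennreal_mult'' mult.commute)
  qed
  let ?G = "\<lambda>z. g (snd z) (fst z)"
  have G: "?G \<in> borel_measurable (count_space C \<Otimes>\<^sub>M count_space A)"
    by (simp add: pair_measure_countable countable)
  then have G': "?G \<in> borel_measurable (?DY \<Otimes>\<^sub>M ?DX)"
    by (simp cong: measurable_cong_sets sets_pair_measure_cong)
  have "(\<integral>\<^sup>+\<omega>. g (X \<omega>) (Y \<omega>) \<partial>M) = integral\<^sup>N (?DY \<Otimes>\<^sub>M ?DX) ?G"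
    unfolding joint by (subst nn_integral_distr[OF YX]) (use G in auto)
  also have "\<dots> = (\<integral>\<^sup>+y. \<integral>\<^sup>+x. g x y \<partial>?DX \<partial>?DY)"
    using DX.nn_integral_fst[OF G'] by simp
  also have "\<dots> = (\<integral>\<^sup>+\<omega>'. \<integral>\<^sup>+\<omega>. g (X \<omega>) (Y \<omega>') \<partial>M \<partial>M)"
    by (subst nn_integral_distr[OF Y]) (auto simp: nn_integral_distr[OF X])
  finally show ?thesis .
qed

locale random_sampling = prob_space M for M :: "'w measure" +
  fixes m :: nat and i j :: "nat \<Rightarrow> 'w \<Rightarrow> nat" and q :: "nat pmf"
  assumes m_pos: "0 < m"
    and i_unif: "\<And>k. distr M (count_space {1..m}) (i k) = uniform_count_measure {1..m}"
    and j_dist: "\<And>k. distr M (count_space UNIV) (j k) = measure_pmf q"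
    and ij_indep: "\<And>k. indep_rv M (count_space {1..m}) (i k) (count_space UNIV) (j k)"
    and hist_indep: "\<And>k. indep_rv M
          (count_space {1..m} \<Otimes>\<^sub>M count_space UNIV) (\<lambda>\<omega>. (i k \<omega>, j k \<omega>))
          (\<Pi>\<^sub>M l\<in>{..<k}. count_space {1..m} \<Otimes>\<^sub>M count_space UNIV)
          (\<lambda>\<omega>. \<lambda>l\<in>{..<k}. (i l \<omega>, j l \<omega>))"
begin

definition history :: "nat \<Rightarrow> 'w \<Rightarrow> nat \<Rightarrow> nat \<times> nat" where
  "history k \<omega> = (\<lambda>l\<in>{..<k}. (i l \<omega>, j l \<omega>))"

text \<open>
  Being determined by the draws before time \<open>k\<close>.  Since there are only countably many histories,
  this pointwise condition implies measurability and plays the part of adaptedness to a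
  filtration.
\<close>
definition hist_det :: "nat \<Rightarrow> ('w \<Rightarrow> 'b) \<Rightarrow> bool" where
  "hist_det k g \<longleftrightarrow>
     (\<forall>\<omega>\<in>space M. \<forall>\<omega>'\<in>space M. history k \<omega> = history k \<omega>' \<longrightarrow> g \<omega> = g \<omega>')"

lemma hist_det_comp: "hist_det k g \<Longrightarrow> hist_det k (\<lambda>\<omega>. F (g \<omega>))"
  unfolding hist_det_def by (intro ballI impI arg_cong[where f = F]) blast

lemma hist_det_comp2: "hist_det k g \<Longrightarrow> hist_det k h \<Longrightarrow> hist_det k (\<lambda>\<omega>. F (g \<omega>) (h \<omega>))"
  unfolding hist_det_def by (intro ballI impI arg_cong2[where f = F]) blast+

lemma history_eq_iff: "history k \<omega> = history k \<omega>' \<longleftrightarrow> (\<forall>l<k. i l \<omega> = i l \<omega>' \<and> j l \<omega> = j l \<omega>')"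
  unfolding history_def restrict_def by (auto simp: fun_eq_iff)

lemma hist_det_sample: "l < k \<Longrightarrow> hist_det k (i l)" "l < k \<Longrightarrow> hist_det k (j l)"
  unfolding hist_det_def history_eq_iff by auto

text \<open>
  A canonical sample point is chosen for every history.
\<close>
lemma hist_det_factor:
  assumes "hist_det k g" obtains \<phi> where "\<And>\<omega>. \<omega> \<in> space M \<Longrightarrow> g \<omega> = \<phi> (history k \<omega>)"
proof (rule that)
  fix \<omega> assume \<omega>: "\<omega> \<in> space M"
  let ?\<omega> = "SOME \<omega>'. \<omega>' \<in> space M \<and> history k \<omega>' = history k \<omega>"
  have "?\<omega> \<in> space M \<and> history k ?\<omega> = history k \<omega>"
    by (rule someI[of _ \<omega>]) (simp add: \<omega>)
  with assms \<omega> show "g \<omega> = (\<lambda>h. g (SOME \<omega>'. \<omega>' \<in> space M \<and> history k \<omega>' = h)) (history k \<omega>)"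
    unfolding hist_det_def by metis
qed

abbreviation histories :: "nat \<Rightarrow> (nat \<Rightarrow> nat \<times> nat) set" where
  "histories k \<equiv> {..<k} \<rightarrow>\<^sub>E ({1..m} \<times> UNIV)"

lemma countable_histories: "countable (histories k)"
  by (intro countable_PiE) auto

lemma history_indep:
  "indep_rv M (count_space ({1..m} \<times> UNIV)) (\<lambda>\<omega>. (i k \<omega>, j k \<omega>)) (count_space (histories k)) (history k)"
proof -
  have 1: "count_space {1..m} \<Otimes>\<^sub>M count_space (UNIV :: nat set) = count_space ({1..m} \<times> UNIV)"
    by (intro pair_measure_countable) auto
  have 2: "(\<Pi>\<^sub>M l\<in>{..<k}. count_space ({1..m} \<times> (UNIV :: nat set))) = count_space (histories k)"
    by (intro count_space_PiM_finite) auto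
  show ?thesis using hist_indep[of k] unfolding 1 2 history_def .
qed

lemma measurable_history: "history k \<in> measurable M (count_space (histories k))"
  using history_indep[of k] by (simp add: indep_rv_def)

lemma measurable_i: "i k \<in> measurable M (count_space {1..m})"
  and measurable_j: "j k \<in> measurable M (count_space UNIV)"
  using ij_indep[of k] by (simp_all add: indep_rv_def)

lemma i_range: "\<omega> \<in> space M \<Longrightarrow> i k \<omega> \<in> {1..m}"
  using measurable_space[OF measurable_i] by simp

lemma hist_det_measurable:
  assumes "hist_det k g" "space N = UNIV" shows "g \<in> measurable M N"
proof -
  obtain \<phi> where \<phi>: "\<And>\<omega>. \<omega> \<in> space M \<Longrightarrow> g \<omega> = \<phi> (history k \<omega>)"
    using hist_det_factor[OF assms(1)] by blast
  have "(\<lambda>\<omega>. \<phi> (history k \<omega>)) \<in> measurable M N"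
    by (rule measurable_compose[OF measurable_history]) (simp add: assms(2))
  then show ?thesis using \<phi> by (simp cong: measurable_cong)
qed

lemma nn_integral_sample_pair:
  "(\<integral>\<^sup>+\<omega>. g (i k \<omega>) (j k \<omega>) \<partial>M)
     = (\<integral>\<^sup>+t. ennreal (1 / real m) * (\<Sum>a=1..m. g a t) \<partial>measure_pmf q)"
proof -
  have "(\<integral>\<^sup>+\<omega>. g (i k \<omega>) (j k \<omega>) \<partial>M) = (\<integral>\<^sup>+\<omega>'. \<integral>\<^sup>+\<omega>. g (i k \<omega>) (j k \<omega>') \<partial>M \<partial>M)"
    by (rule nn_integral_indep_rv_countable[OF prob_space_axioms ij_indep]) auto
  also have "\<dots> = (\<integral>\<^sup>+\<omega>'. \<integral>\<^sup>+a. g a (j k \<omega>') \<partial>uniform_count_measure {1..m} \<partial>M)"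
    unfolding i_unif[of k, symmetric] by (simp add: nn_integral_distr[OF measurable_i] del: One_nat_def)
  also have "\<dots> = (\<integral>\<^sup>+t. \<integral>\<^sup>+a. g a t \<partial>uniform_count_measure {1..m} \<partial>measure_pmf q)"
    by (simp add: j_dist[of k, symmetric] nn_integral_distr[OF measurable_j])
  also have "\<dots> = (\<integral>\<^sup>+t. ennreal (1 / real m) * (\<Sum>a=1..m. g a t) \<partial>measure_pmf q)"
    by (simp add: uniform_count_measure_def nn_integral_point_measure_finite sum_distrib_left)
  finally show ?thesis .
qed

text \<open>
  The conditional expectation given the past, written as an unconditional identity: the
  \<open>k\<close>-th draw is averaged out while everything determined by the past is kept.
\<close>
lemma nn_integral_next_sample:
  assumes "\<And>a t. hist_det k (\<lambda>\<omega>. G \<omega> a t)"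
  shows "(\<integral>\<^sup>+\<omega>. G \<omega> (i k \<omega>) (j k \<omega>) \<partial>M)
     = (\<integral>\<^sup>+\<omega>. \<integral>\<^sup>+t. ennreal (1 / real m) * (\<Sum>a=1..m. G \<omega> a t) \<partial>measure_pmf q \<partial>M)"
proof -
  have "hist_det k G" using assms unfolding hist_det_def by (intro ballI impI ext) blast
  then obtain \<phi> where \<phi>: "\<And>\<omega>. \<omega> \<in> space M \<Longrightarrow> G \<omega> = \<phi> (history k \<omega>)"
    using hist_det_factor by blast
  have "(\<integral>\<^sup>+\<omega>. G \<omega> (i k \<omega>) (j k \<omega>) \<partial>M)
      = (\<integral>\<^sup>+\<omega>. (\<lambda>(a, t) h. \<phi> h a t) (i k \<omega>, j k \<omega>) (history k \<omega>) \<partial>M)"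
    by (intro nn_integral_cong) (simp add: \<phi>)
  also have "\<dots> = (\<integral>\<^sup>+\<omega>'. \<integral>\<^sup>+\<omega>. (\<lambda>(a, t) h. \<phi> h a t) (i k \<omega>, j k \<omega>) (history k \<omega>') \<partial>M \<partial>M)"
    by (rule nn_integral_indep_rv_countable[OF prob_space_axioms history_indep])
      (auto intro: countable_histories simp del: One_nat_def)
  also have "\<dots> = (\<integral>\<^sup>+\<omega>'. \<integral>\<^sup>+t. ennreal (1 / real m) * (\<Sum>a=1..m. G \<omega>' a t) \<partial>measure_pmf q \<partial>M)"
    using nn_integral_sample_pair[where k = k]
    by (intro nn_integral_cong) (simp add: \<phi>)
  finally show ?thesis .
qed

text \<open>
  The probability that block \<open>a\<close> is missed in the first \<open>K\<close> draws is \<open>(1 - 1/m)\<^sup>K\<close>.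
\<close>
lemma AE_every_block_drawn: "AE \<omega> in M. \<forall>a\<in>{1..m}. \<exists>k. i k \<omega> = a"
proof (intro AE_ball_countable' countable_finite)
  fix a assume a: "a \<in> {1..m}"
  define c where "c = real (m - 1) / real m"
  have c: "0 \<le> c" "c < 1" using m_pos by (auto simp: c_def)
  let ?miss = "\<lambda>K \<omega>. of_bool (\<forall>k<K. i k \<omega> \<noteq> a) :: ennreal"
  have det: "hist_det K (?miss K)" for K
    unfolding hist_det_def history_eq_iff by auto
  have miss: "(\<integral>\<^sup>+\<omega>. ?miss K \<omega> \<partial>M) = ennreal (c ^ K)" for K
  proof (induction K)
    case 0 then show ?case by (simp add: emeasure_space_1)
  next
    case (Suc K)
    have avg: "ennreal (1 / real m) * (\<Sum>b=1..m. of_bool (b \<noteq> a)) = ennreal c"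
    proof -
      have "(\<Sum>b=1..m. of_bool (b \<noteq> a) :: ennreal) = of_nat (card ({1..m} \<inter> {b. b \<noteq> a}))"
        by (simp add: sum_of_bool_eq del: One_nat_def)
      also have "{1..m} \<inter> {b. b \<noteq> a} = {1..m} - {a}" by auto
      finally have "(\<Sum>b=1..m. of_bool (b \<noteq> a) :: ennreal) = ennreal (real (m - 1))"
        using a by (simp add: ennreal_of_nat_eq_real_of_nat)
      then show ?thesis by (simp add: c_def ennreal_mult[symmetric])
    qed
    have "(\<integral>\<^sup>+\<omega>. ?miss (Suc K) \<omega> \<partial>M) = (\<integral>\<^sup>+\<omega>. ?miss K \<omega> * of_bool (i K \<omega> \<noteq> a) \<partial>M)"
      by (intro nn_integral_cong) (auto simp: less_Suc_eq)
    also have "\<dots> = (\<integral>\<^sup>+\<omega>. \<integral>\<^sup>+t. ennreal (1 / real m) * (\<Sum>b=1..m. ?miss K \<omega> * of_bool (b \<noteq> a)) \<partial>measure_pmf q \<partial>M)"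
      by (rule nn_integral_next_sample[where G = "\<lambda>\<omega> b t. ?miss K \<omega> * of_bool (b \<noteq> a)"])
        (intro hist_det_comp[OF det])
    also have "\<dots> = (\<integral>\<^sup>+\<omega>. ?miss K \<omega> * ennreal c \<partial>M)"
      by (intro nn_integral_cong)
        (simp add: measure_pmf.emeasure_space_1 mult.left_commute avg sum_distrib_left[symmetric] del: One_nat_def sum_of_bool_eq)
    also have "\<dots> = ennreal (c ^ K) * ennreal c"
      unfolding Suc.IH[symmetric]
      by (rule nn_integral_multc) (rule hist_det_measurable[OF det], simp)
    also have "\<dots> = ennreal (c ^ Suc K)"
      unfolding power_Suc2 by (rule ennreal_mult[symmetric]) (use c in simp_all)
    finally show ?case .
  qed
  have i_meas [measurable]: "i k \<in> measurable M (count_space UNIV)" for k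
    by (rule hist_det_measurable[OF hist_det_sample(1)[of k "Suc k"]]) auto
  have "(\<integral>\<^sup>+\<omega>. of_bool (\<forall>k. i k \<omega> \<noteq> a) \<partial>M) = (0 :: ennreal)"
  proof -
    have "(\<integral>\<^sup>+\<omega>. of_bool (\<forall>k. i k \<omega> \<noteq> a) \<partial>M) \<le> ennreal (c ^ K)" for K
      unfolding miss[symmetric] by (intro nn_integral_mono) auto
    moreover have "(\<lambda>K. ennreal (c ^ K)) \<longlonglongrightarrow> ennreal 0"
      by (intro tendsto_ennrealI LIMSEQ_realpow_zero c)
    ultimately have "(\<integral>\<^sup>+\<omega>. of_bool (\<forall>k. i k \<omega> \<noteq> a) \<partial>M) \<le> ennreal 0"
      by (intro LIMSEQ_le_const[of "\<lambda>K. ennreal (c ^ K)"]) auto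
    then show ?thesis by simp
  qed
  then have "AE \<omega> in M. of_bool (\<forall>k. i k \<omega> \<noteq> a) = (0 :: ennreal)"
  proof (subst (asm) nn_integral_0_iff_AE)
    have "(\<lambda>\<omega>. if \<forall>k. i k \<omega> \<noteq> a then 1 else 0 :: ennreal) \<in> borel_measurable M"
      by measurable
    then show "(\<lambda>\<omega>. of_bool (\<forall>k. i k \<omega> \<noteq> a) :: ennreal) \<in> borel_measurable M"
      by (simp add: of_bool_def)
  qed
  then show "AE \<omega> in M. \<exists>k. i k \<omega> = a" by eventually_elim auto
qed auto

end

section \<open>Series, windows and vanishing sequences\<close>
lemma nn_integral_pmf_nat_swap:
  fixes q :: "nat pmf"
  assumes "\<And>t. (\<lambda>\<omega>. g \<omega> t) \<in> borel_measurable M"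
  shows "(\<integral>\<^sup>+\<omega>. \<integral>\<^sup>+t. g \<omega> t \<partial>measure_pmf q \<partial>M) = (\<integral>\<^sup>+t. \<integral>\<^sup>+\<omega>. g \<omega> t \<partial>M \<partial>measure_pmf q)"
  unfolding nn_integral_measure_pmf nn_integral_count_space_nat
  using assms by (simp add: nn_integral_suminf nn_integral_cmult)

lemma nn_integral_pmf_ge_point:
  "ennreal (pmf q t) * g t \<le> (\<integral>\<^sup>+t. g t \<partial>measure_pmf q)"
  unfolding nn_integral_measure_pmf by (rule nn_integral_ge_point) simp

lemma AE_tendsto_zero_if_sum_finite:
  fixes g :: "nat \<Rightarrow> 'a \<Rightarrow> real"
  assumes meas: "\<And>k. (\<lambda>\<omega>. of_bool (P \<omega>) * ennreal (g k \<omega>)) \<in> borel_measurable M"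
    and nonneg: "\<And>k \<omega>. 0 \<le> g k \<omega>"
    and finite: "(\<Sum>k. \<integral>\<^sup>+\<omega>. of_bool (P \<omega>) * ennreal (g k \<omega>) \<partial>M) < \<top>"
  shows "AE \<omega> in M. P \<omega> \<longrightarrow> (\<lambda>k. g k \<omega>) \<longlonglongrightarrow> 0"
proof -
  have "(\<integral>\<^sup>+\<omega>. (\<Sum>k. of_bool (P \<omega>) * ennreal (g k \<omega>)) \<partial>M) < \<top>"
    unfolding nn_integral_suminf[OF meas] by (rule finite)
  then have "AE \<omega> in M. (\<Sum>k. of_bool (P \<omega>) * ennreal (g k \<omega>)) \<noteq> \<infinity>"
    by (intro nn_integral_PInf_AE borel_measurable_suminf_order meas) auto
  then show ?thesis
  proof eventually_elim
    case (elim \<omega>)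
    show ?case
    proof
      assume "P \<omega>"
      with elim have "(\<Sum>k. ennreal (g k \<omega>)) \<noteq> \<top>" by simp
      then have "summable (\<lambda>k. g k \<omega>)" by (intro summable_suminf_not_top nonneg)
      then show "(\<lambda>k. g k \<omega>) \<longlonglongrightarrow> 0" by (rule summable_LIMSEQ_zero)
    qed
  qed
qed

lemma tendsto_zero_if_norm_square:
  fixes v :: "nat \<Rightarrow> 'a::real_normed_vector"
  assumes "(\<lambda>k. c * (norm (v k))\<^sup>2) \<longlonglongrightarrow> 0" "0 < c"
  shows "v \<longlonglongrightarrow> 0"
proof -
  have "(\<lambda>k. (1 / c) * (c * (norm (v k))\<^sup>2)) \<longlonglongrightarrow> 0"
    by (intro tendsto_mult_right_zero assms)
  then have "(\<lambda>k. sqrt ((norm (v k))\<^sup>2)) \<longlonglongrightarrow> sqrt 0"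
    using assms(2) by (intro tendsto_real_sqrt) simp
  then show ?thesis by (simp add: tendsto_norm_zero_iff)
qed

lemma delayed_difference_tendsto_zero:
  fixes X :: "nat \<Rightarrow> 'a::real_normed_vector"
  assumes "(\<lambda>k. X (Suc k) - X k) \<longlonglongrightarrow> 0"
  shows "(\<lambda>k. X k - X (k - t)) \<longlonglongrightarrow> 0"
proof (induction t)
  case 0 show ?case by simp
next
  case (Suc t)
  have "(\<lambda>k. X (k + Suc t - t) - X (k + Suc t - Suc t)) \<longlonglongrightarrow> 0"
    using assms by (simp add: Suc_diff_le)
  then have "(\<lambda>k. X (k - t) - X (k - Suc t)) \<longlonglongrightarrow> 0"
    by (rule LIMSEQ_offset[of _ "Suc t"])
  from tendsto_add[OF Suc.IH this] show ?case by simp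
qed

text \<open>
  The index \<open>l\<close> lies in the window before \<open>k\<close> only for \<open>k\<close> in \<open>{l<..l + t}\<close>.
\<close>
lemma sum_windows_le:
  fixes a :: "nat \<Rightarrow> ennreal"
  shows "(\<Sum>k<K. \<Sum>l\<in>{k - t..<k}. a l) \<le> of_nat t * (\<Sum>l<K. a l)"
proof -
  have "(\<Sum>k<K. \<Sum>l\<in>{k - t..<k}. a l) = (\<Sum>k<K. \<Sum>l<K. of_bool (l \<in> {k - t..<k}) * a l)"
  proof (rule sum.cong[OF refl])
    fix k assume "k \<in> {..<K}"
    then have "{k - t..<k} = {l \<in> {..<K}. l \<in> {k - t..<k}}" by auto
    then have "(\<Sum>l\<in>{k - t..<k}. a l) = (\<Sum>l\<in>{l \<in> {..<K}. l \<in> {k - t..<k}}. a l)" by simp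
    also have "\<dots> = (\<Sum>l<K. if l \<in> {k - t..<k} then a l else 0)"
      by (rule sum.inter_filter) simp
    also have "\<dots> = (\<Sum>l<K. of_bool (l \<in> {k - t..<k}) * a l)"
      by (rule sum.cong[OF refl]) auto
    finally show "(\<Sum>l\<in>{k - t..<k}. a l) = (\<Sum>l<K. of_bool (l \<in> {k - t..<k}) * a l)" .
  qed
  also have "\<dots> = (\<Sum>l<K. (\<Sum>k<K. of_bool (l \<in> {k - t..<k})) * a l)"
    by (subst sum.swap) (simp add: sum_distrib_right)
  also have "\<dots> \<le> (\<Sum>l<K. of_nat t * a l)"
  proof (intro sum_mono mult_right_mono)
    fix l
    have "(\<Sum>k<K. of_bool (l \<in> {k - t..<k}) :: ennreal) = of_nat (card ({..<K} \<inter> {k. l \<in> {k - t..<k}}))"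
      by simp
    also have "{..<K} \<inter> {k. l \<in> {k - t..<k}} \<subseteq> {l<..l + t}" by auto
    then have "card ({..<K} \<inter> {k. l \<in> {k - t..<k}}) \<le> t"
      using card_mono[of "{l<..l + t}"] by fastforce
    finally show "(\<Sum>k<K. of_bool (l \<in> {k - t..<k})) \<le> (of_nat t :: ennreal)" by simp
  qed simp
  finally show ?thesis by (simp add: sum_distrib_left)
qed

section \<open>Summability of the expected squared steps\<close>

text \<open>
  The stepsize condition appears in the form in which it is used: the coefficient of the delay
  error is smaller than the coefficient of the decrease.
\<close>
locale async_process =
  composite_problem B m f r Lf Lr Lc \<eta> + random_sampling M m i j q
  for B :: "nat \<Rightarrow> 'n::finite set" and m f r Lf Lr Lc \<eta> and M :: "'w measure" and i j q +
  fixes x0 :: "real ^ 'n" and x :: "nat \<Rightarrow> 'w \<Rightarrow> real ^ 'n" and S c :: real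
  assumes x_alg: "\<And>\<omega>. \<omega> \<in> space M \<Longrightarrow>
          async_bcu B m f r \<eta> x0 (\<lambda>k. i k \<omega>) (\<lambda>k. j k \<omega>) (\<lambda>k. x k \<omega>)"
    and S_finite: "integrable (measure_pmf q) (\<lambda>t. (real t)\<^sup>2)"
    and S_eq: "S = measure_pmf.expectation q (\<lambda>t. (real t)\<^sup>2)"
    and bounded_below: "\<And>y. ereal c \<le> ereal (f y) + block_sum B m r y"
    and stepsize: "Lr\<^sup>2 * S / (2 * real m * Lc) < 1 / \<eta> - Lc"
begin

lemma x_0: "\<omega> \<in> space M \<Longrightarrow> x 0 \<omega> = x0"
  using x_alg[of \<omega>] by (simp add: async_bcu_def)

lemma x_Suc:
  "\<omega> \<in> space M \<Longrightarrow> x (Suc k) \<omega> = x k \<omega> + incr (i k \<omega>) (x k \<omega>) (x (k - j k \<omega>) \<omega>)"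
  by (rule async_bcu_step[OF x_alg i_range])

lemma hist_det_x: "l \<le> k \<Longrightarrow> hist_det k (x l)"
proof (induction l rule: less_induct)
  case (less l)
  show ?case
  proof (cases l)
    case 0
    then show ?thesis by (simp add: hist_det_def x_0)
  next
    case (Suc l')
    show ?thesis unfolding hist_det_def
    proof (intro ballI impI)
      fix \<omega> \<omega>' assume \<omega>: "\<omega> \<in> space M" "\<omega>' \<in> space M" and h: "history k \<omega> = history k \<omega>'"
      have ij: "i l' \<omega> = i l' \<omega>'" "j l' \<omega> = j l' \<omega>'"
        using h less.prems Suc by (auto simp: history_eq_iff)
      have x: "x n \<omega> = x n \<omega>'" if "n \<le> l'" for n
      proof -
        have "hist_det k (x n)" using less.IH[of n] less.prems that Suc by simp
        then show ?thesis using \<omega> h unfolding hist_det_def by blast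
      qed
      show "x l \<omega> = x l \<omega>'"
        unfolding Suc x_Suc[OF \<omega>(1)] x_Suc[OF \<omega>(2)] ij by (simp add: x)
    qed
  qed
qed

text \<open>
  The delayed index is one of \<open>0, \<dots>, k\<close>, so infinitely many delays still lead to finitely many
  successors.  This makes the expected squared steps and the expected energies finite.
\<close>
lemma finite_range_x: "finite (x k ` space M)"
proof (induction k rule: less_induct)
  case (less k)
  show ?case
  proof (cases k)
    case 0
    have "x 0 ` space M \<subseteq> {x0}" using x_0 by auto
    then show ?thesis unfolding 0 by (rule finite_subset) simp
  next
    case (Suc l)
    let ?D = "{1..m} \<times> (x l ` space M) \<times> (\<Union>n\<le>l. x n ` space M)"
    have "x k ` space M \<subseteq> (\<lambda>(a, u, w). u + incr a u w) ` ?D"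
    proof
      fix y assume "y \<in> x k ` space M"
      then obtain \<omega> where \<omega>: "\<omega> \<in> space M" "y = x k \<omega>" by blast
      have "(i l \<omega>, x l \<omega>, x (l - j l \<omega>) \<omega>) \<in> ?D"
        using \<omega>(1) i_range[OF \<omega>(1), of l] by (auto intro!: bexI[of _ "l - j l \<omega>"])
      moreover have "y = (\<lambda>(a, u, w). u + incr a u w) (i l \<omega>, x l \<omega>, x (l - j l \<omega>) \<omega>)"
        using x_Suc[OF \<omega>(1)] \<omega>(2) Suc by simp
      ultimately show "y \<in> (\<lambda>(a, u, w). u + incr a u w) ` ?D" by blast
    qed
    moreover have "finite ?D"
      using less.IH Suc by (auto intro!: finite_cartesian_product simp del: One_nat_def)
    ultimately show ?thesis by (meson finite_imageI finite_subset)
  qed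
qed

lemma nn_integral_bounded_finite:
  assumes "finite (g ` space M)"
  shows "(\<integral>\<^sup>+\<omega>. of_bool (P \<omega>) * ennreal (g \<omega>) \<partial>M) < \<top>"
proof -
  obtain C where C: "\<And>\<omega>. \<omega> \<in> space M \<Longrightarrow> g \<omega> \<le> C"
    using finite_imp_bounded[OF assms] bounded_imp_bdd_above unfolding bdd_above_def by (metis imageI)
  have "(\<integral>\<^sup>+\<omega>. of_bool (P \<omega>) * ennreal (g \<omega>) \<partial>M) \<le> (\<integral>\<^sup>+\<omega>. ennreal C \<partial>M)"
    by (intro nn_integral_mono) (auto intro!: ennreal_leI C)
  also have "\<dots> < \<top>" by (simp add: emeasure_space_1)
  finally show ?thesis .
qed

lemma feasible_x_mono:
  assumes "\<omega> \<in> space M" "feasible (x N \<omega>)" "N \<le> k" shows "feasible (x k \<omega>)"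
  using assms(3)
proof (induction rule: dec_induct)
  case base show ?case by (rule assms(2))
next
  case (step k)
  show ?case
    unfolding x_Suc[OF assms(1)] by (rule feasible_step[OF i_range[OF assms(1)] step.IH])
qed

text \<open>
  A value of the proximal mapping has a finite block term, and a block keeps this property
  through later updates; hence feasibility holds once every block has been drawn.
\<close>
lemma AE_eventually_feasible: "AE \<omega> in M. \<exists>N. feasible (x N \<omega>)"
  using AE_every_block_drawn AE_space
proof eventually_elim
  case (elim \<omega>)
  then have \<omega>: "\<omega> \<in> space M" by simp
  have "\<forall>\<^sub>F k in sequentially. r a (blk B a (x k \<omega>)) \<noteq> \<infinity>" if a: "a \<in> {1..m}" for a
  proof -
    obtain k0 where k0: "i k0 \<omega> = a" using elim a by blast
    have "r a (blk B a (x k \<omega>)) \<noteq> \<infinity>" if "Suc k0 \<le> k" for k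
      using that
    proof (induction rule: dec_induct)
      case base
      show ?case
        unfolding x_Suc[OF \<omega>] k0 blk_step[OF a a]
        using r_prox_grad_finite[OF a, of "x k0 \<omega>" "x (k0 - j k0 \<omega>) \<omega>"] by auto
    next
      case (step k)
      show ?case
        unfolding x_Suc[OF \<omega>] blk_step[OF i_range[OF \<omega>] a]
        using r_prox_grad_finite[OF a, of "x k \<omega>" "x (k - j k \<omega>) \<omega>"] step.IH by auto
    qed
    then show ?thesis unfolding eventually_sequentially by blast
  qed
  then have "\<forall>\<^sub>F k in sequentially. \<forall>a\<in>{1..m}. r a (blk B a (x k \<omega>)) \<noteq> \<infinity>"
    by (intro eventually_ball_finite) auto
  then show ?case unfolding feasible_def eventually_sequentially by blast
qed

text \<open>
  All expectations are restricted to the event that \<open>x N\<close> is feasible.  For \<open>k \<ge> N\<close> this event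
  is determined by the past of time \<open>k\<close>, so it does not interfere with averaging over the
  \<open>k\<close>-th draw.
\<close>
definition expected_sq_step :: "nat \<Rightarrow> nat \<Rightarrow> ennreal" where
  "expected_sq_step N k = (\<integral>\<^sup>+\<omega>. of_bool (feasible (x N \<omega>)) * ennreal ((norm (x (Suc k) \<omega> - x k \<omega>))\<^sup>2) \<partial>M)"

definition expected_sq_delay :: "nat \<Rightarrow> nat \<Rightarrow> ennreal" where
  "expected_sq_delay N k = (\<integral>\<^sup>+\<omega>. of_bool (feasible (x N \<omega>)) *
     ennreal ((norm (blk B (i k \<omega>) (grad f (x k \<omega>) - grad f (x (k - j k \<omega>) \<omega>))))\<^sup>2) \<partial>M)"

definition expected_energy :: "nat \<Rightarrow> nat \<Rightarrow> ennreal" where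
  "expected_energy N k = (\<integral>\<^sup>+\<omega>. of_bool (feasible (x N \<omega>)) * ennreal (energy (x k \<omega>) - c) \<partial>M)"

lemma measurable_x_fun:
  "(\<lambda>\<omega>. of_bool (feasible (x N \<omega>)) * ennreal (g (x k \<omega>) (x l \<omega>))) \<in> borel_measurable M"
proof -
  let ?K = "max N (max k l)"
  have "hist_det ?K (\<lambda>\<omega>. (of_bool (feasible (x N \<omega>)) :: ennreal))"
    by (rule hist_det_comp[OF hist_det_x[of N], where F = "\<lambda>u. of_bool (feasible u)"]) simp
  moreover have "hist_det ?K (\<lambda>\<omega>. ennreal (g (x k \<omega>) (x l \<omega>)))"
    by (rule hist_det_comp2[OF hist_det_x[of k] hist_det_x[of l], where F = "\<lambda>u v. ennreal (g u v)"]) simp_all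
  ultimately have "hist_det ?K (\<lambda>\<omega>. of_bool (feasible (x N \<omega>)) * ennreal (g (x k \<omega>) (x l \<omega>)))"
    by (rule hist_det_comp2[where F = "(*)"])
  then show ?thesis by (rule hist_det_measurable) simp
qed

lemma expected_sq_step_finite: "expected_sq_step N k < \<top>"
proof -
  let ?D = "x k ` space M \<times> x (Suc k) ` space M"
  have "(\<lambda>\<omega>. (norm (x (Suc k) \<omega> - x k \<omega>))\<^sup>2) ` space M \<subseteq> (\<lambda>(u, v). (norm (v - u))\<^sup>2) ` ?D"
    by auto
  moreover have "finite ?D" by (intro finite_cartesian_product finite_range_x)
  ultimately show ?thesis
    unfolding expected_sq_step_def by (intro nn_integral_bounded_finite) (meson finite_imageI finite_subset)
qed

lemma expected_energy_finite: "expected_energy N k < \<top>"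
proof -
  have "(\<lambda>\<omega>. energy (x k \<omega>) - c) ` space M = (\<lambda>u. energy u - c) ` x k ` space M" by auto
  then show ?thesis
    unfolding expected_energy_def by (intro nn_integral_bounded_finite) (simp add: finite_range_x)
qed

lemma energy_bounded_below: "feasible u \<Longrightarrow> c \<le> energy u"
  using bounded_below[of u] objective_eq_energy[of u] by simp

lemma nn_integral_next_sample_x:
  assumes "N \<le> k"
  shows "(\<integral>\<^sup>+\<omega>. of_bool (feasible (x N \<omega>)) * ennreal (g (i k \<omega>) (x k \<omega>) (x (k - j k \<omega>) \<omega>)) \<partial>M)
    = (\<integral>\<^sup>+t. \<integral>\<^sup>+\<omega>. ennreal (1 / real m) * (\<Sum>a=1..m. of_bool (feasible (x N \<omega>)) * ennreal (g a (x k \<omega>) (x (k - t) \<omega>))) \<partial>M \<partial>measure_pmf q)"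
    (is "?l = ?r")
proof -
  let ?G = "\<lambda>\<omega> a t. of_bool (feasible (x N \<omega>)) * ennreal (g a (x k \<omega>) (x (k - t) \<omega>))"
  have det: "hist_det k (\<lambda>\<omega>. ?G \<omega> a t)" for a t
  proof (rule hist_det_comp2[where F = "(*)"])
    show "hist_det k (\<lambda>\<omega>. (of_bool (feasible (x N \<omega>)) :: ennreal))"
      by (rule hist_det_comp[OF hist_det_x[of N], where F = "\<lambda>u. of_bool (feasible u)", OF assms])
    show "hist_det k (\<lambda>\<omega>. ennreal (g a (x k \<omega>) (x (k - t) \<omega>)))"
      by (rule hist_det_comp2[OF hist_det_x[of k] hist_det_x[of "k - t"], where F = "\<lambda>u v. ennreal (g a u v)"]) simp_all
  qed
  have "?l = (\<integral>\<^sup>+\<omega>. \<integral>\<^sup>+t. ennreal (1 / real m) * (\<Sum>a=1..m. ?G \<omega> a t) \<partial>measure_pmf q \<partial>M)"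
    by (rule nn_integral_next_sample[where G = ?G, OF det])
  also have "\<dots> = ?r"
    by (intro nn_integral_pmf_nat_swap borel_measurable_times_ennreal borel_measurable_sum measurable_x_fun) simp
  finally show ?thesis .
qed

text \<open>
  Averaging over the drawn block turns the block norms into \<open>1/m\<close> times the squared norm of
  the whole gradient difference.
\<close>
lemma expected_sq_delay_le:
  assumes "N \<le> k"
  shows "expected_sq_delay N k \<le> (\<integral>\<^sup>+t. ennreal (Lr\<^sup>2 / real m * real t) * (\<Sum>l\<in>{k - t..<k}. expected_sq_step N l) \<partial>measure_pmf q)"
proof -
  let ?ind = "\<lambda>\<omega>. of_bool (feasible (x N \<omega>)) :: ennreal"
  let ?d = "\<lambda>l \<omega>. (norm (x (Suc l) \<omega> - x l \<omega>))\<^sup>2"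
  have "expected_sq_delay N k = (\<integral>\<^sup>+t. \<integral>\<^sup>+\<omega>. ennreal (1 / real m) * (\<Sum>a=1..m. ?ind \<omega> *
      ennreal ((norm (blk B a (grad f (x k \<omega>) - grad f (x (k - t) \<omega>))))\<^sup>2)) \<partial>M \<partial>measure_pmf q)"
    unfolding expected_sq_delay_def
    by (rule nn_integral_next_sample_x[OF assms, where g = "\<lambda>a u w. (norm (blk B a (grad f u - grad f w)))\<^sup>2"])
  also have "\<dots> \<le> (\<integral>\<^sup>+t. \<integral>\<^sup>+\<omega>. ennreal (Lr\<^sup>2 / real m * real t) * (\<Sum>l\<in>{k - t..<k}. ?ind \<omega> * ennreal (?d l \<omega>)) \<partial>M \<partial>measure_pmf q)"
  proof (intro nn_integral_mono)
    fix t \<omega> assume \<omega>: "\<omega> \<in> space M"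
    let ?w = "grad f (x k \<omega>) - grad f (x (k - t) \<omega>)"
    have "(\<Sum>a=1..m. ?ind \<omega> * ennreal ((norm (blk B a ?w))\<^sup>2)) = ?ind \<omega> * ennreal ((norm ?w)\<^sup>2)"
      unfolding sum_distrib_left[symmetric] sum_norm_blk[OF blocks, of ?w, symmetric]
      by (subst sum_ennreal) auto
    moreover have "(norm ?w)\<^sup>2 \<le> Lr\<^sup>2 * (real t * (\<Sum>l\<in>{k - t..<k}. ?d l \<omega>))"
    proof (rule delayed_gradient_error[where X = "\<lambda>k. x k \<omega>"])
      fix l
      show "i l \<omega> \<in> {1..m} \<and> blk B (i l \<omega>) (x (Suc l) \<omega> - x l \<omega>) = x (Suc l) \<omega> - x l \<omega>"
        using i_range[OF \<omega>, of l] blk_incr[OF i_range[OF \<omega>, of l]] by (simp add: x_Suc[OF \<omega>])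
    qed
    then have "1 / real m * (norm ?w)\<^sup>2 \<le> 1 / real m * (Lr\<^sup>2 * (real t * (\<Sum>l\<in>{k - t..<k}. ?d l \<omega>)))"
      by (intro mult_left_mono) auto
    then have "ennreal (1 / real m * (norm ?w)\<^sup>2) \<le> ennreal ((Lr\<^sup>2 / real m * real t) * (\<Sum>l\<in>{k - t..<k}. ?d l \<omega>))"
      by (intro ennreal_leI) (simp add: mult.assoc)
    then have "ennreal (1 / real m) * ennreal ((norm ?w)\<^sup>2)
        \<le> ennreal (Lr\<^sup>2 / real m * real t) * (\<Sum>l\<in>{k - t..<k}. ennreal (?d l \<omega>))"
      by (subst sum_ennreal) (simp_all add: ennreal_mult'[symmetric] sum_nonneg)
    ultimately show "ennreal (1 / real m) * (\<Sum>a=1..m. ?ind \<omega> * ennreal ((norm (blk B a ?w))\<^sup>2))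
        \<le> ennreal (Lr\<^sup>2 / real m * real t) * (\<Sum>l\<in>{k - t..<k}. ?ind \<omega> * ennreal (?d l \<omega>))"
      by (cases "feasible (x N \<omega>)") auto
  qed
  also have "\<dots> = (\<integral>\<^sup>+t. ennreal (Lr\<^sup>2 / real m * real t) * (\<Sum>l\<in>{k - t..<k}. expected_sq_step N l) \<partial>measure_pmf q)"
  proof (intro nn_integral_cong)
    fix t
    have meas: "(\<lambda>\<omega>. ?ind \<omega> * ennreal (?d l \<omega>)) \<in> borel_measurable M" for l
      using measurable_x_fun[of N "\<lambda>u v. (norm (v - u))\<^sup>2" l "Suc l"] .
    show "(\<integral>\<^sup>+\<omega>. ennreal (Lr\<^sup>2 / real m * real t) * (\<Sum>l\<in>{k - t..<k}. ?ind \<omega> * ennreal (?d l \<omega>)) \<partial>M)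
        = ennreal (Lr\<^sup>2 / real m * real t) * (\<Sum>l\<in>{k - t..<k}. expected_sq_step N l)"
      unfolding expected_sq_step_def
      by (subst nn_integral_cmult, intro borel_measurable_sum meas) (subst nn_integral_sum[OF meas], rule refl)
  qed
  finally show ?thesis .
qed

lemma expected_descent:
  assumes "N \<le> k"
  shows "expected_energy N (Suc k) + ennreal (1 / \<eta> - Lc) * expected_sq_step N k
           \<le> expected_energy N k + ennreal (1 / (2 * Lc)) * expected_sq_delay N k"
proof -
  let ?ind = "\<lambda>\<omega>. of_bool (feasible (x N \<omega>)) :: ennreal"
  let ?d = "\<lambda>\<omega>. (norm (x (Suc k) \<omega> - x k \<omega>))\<^sup>2"
  let ?e = "\<lambda>k \<omega>. energy (x k \<omega>) - c"
  let ?w = "\<lambda>\<omega>. (norm (blk B (i k \<omega>) (grad f (x k \<omega>) - grad f (x (k - j k \<omega>) \<omega>))))\<^sup>2"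
  have "0 \<le> S" unfolding S_eq by (rule Bochner_Integration.integral_nonneg) simp
  then have "0 \<le> Lr\<^sup>2 * S / (2 * real m * Lc)" using Lc_pos by simp
  then have pos: "0 \<le> 1 / \<eta> - Lc" "0 \<le> 1 / (2 * Lc)" using stepsize Lc_pos by auto
  have me: "(\<lambda>\<omega>. ?ind \<omega> * ennreal (?e k \<omega>)) \<in> borel_measurable M" for k
    using measurable_x_fun[of N "\<lambda>u v. energy u - c" k k] .
  have md: "(\<lambda>\<omega>. ?ind \<omega> * ennreal (?d \<omega>)) \<in> borel_measurable M"
    using measurable_x_fun[of N "\<lambda>u v. (norm (v - u))\<^sup>2" k "Suc k"] .
  have mw: "(\<lambda>\<omega>. ?ind \<omega> * ennreal (?w \<omega>)) \<in> borel_measurable M"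
  proof (rule hist_det_measurable[of "Suc k"])
    show "hist_det (Suc k) (\<lambda>\<omega>. ?ind \<omega> * ennreal (?w \<omega>))"
      unfolding hist_det_def
    proof (intro ballI impI)
      fix \<omega> \<omega>' assume \<omega>: "\<omega> \<in> space M" "\<omega>' \<in> space M" "history (Suc k) \<omega> = history (Suc k) \<omega>'"
      have "x l \<omega> = x l \<omega>'" if "l \<le> Suc k" for l
        using hist_det_x[OF that] \<omega> unfolding hist_det_def by blast
      moreover have "i k \<omega> = i k \<omega>'" "j k \<omega> = j k \<omega>'" using \<omega>(3) by (auto simp: history_eq_iff)
      ultimately show "?ind \<omega> * ennreal (?w \<omega>) = ?ind \<omega>' * ennreal (?w \<omega>')"
        using assms by simp
    qed
  qed simp
  have "expected_energy N (Suc k) + ennreal (1 / \<eta> - Lc) * expected_sq_step N k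
      = (\<integral>\<^sup>+\<omega>. ?ind \<omega> * ennreal (?e (Suc k) \<omega>) + ennreal (1 / \<eta> - Lc) * (?ind \<omega> * ennreal (?d \<omega>)) \<partial>M)"
    unfolding expected_energy_def expected_sq_step_def
    by (subst nn_integral_add) (auto intro!: me md borel_measurable_times_ennreal simp: nn_integral_cmult[OF md])
  also have "\<dots> \<le> (\<integral>\<^sup>+\<omega>. ?ind \<omega> * ennreal (?e k \<omega>) + ennreal (1 / (2 * Lc)) * (?ind \<omega> * ennreal (?w \<omega>)) \<partial>M)"
  proof (intro nn_integral_mono)
    fix \<omega> assume \<omega>: "\<omega> \<in> space M"
    show "?ind \<omega> * ennreal (?e (Suc k) \<omega>) + ennreal (1 / \<eta> - Lc) * (?ind \<omega> * ennreal (?d \<omega>))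
        \<le> ?ind \<omega> * ennreal (?e k \<omega>) + ennreal (1 / (2 * Lc)) * (?ind \<omega> * ennreal (?w \<omega>))"
    proof (cases "feasible (x N \<omega>)")
      case True
      have fk: "feasible (x k \<omega>)" "feasible (x (Suc k) \<omega>)"
        using feasible_x_mono[OF \<omega> True] assms by auto
      then have ge: "0 \<le> ?e k \<omega>" "0 \<le> ?e (Suc k) \<omega>" by (auto simp: energy_bounded_below)
      have "?e (Suc k) \<omega> + (1 / \<eta> - Lc) * ?d \<omega> \<le> ?e k \<omega> + 1 / (2 * Lc) * ?w \<omega>"
        using energy_descent[OF i_range[OF \<omega>, of k] fk(1), of "x (k - j k \<omega>) \<omega>"]
        by (simp add: x_Suc[OF \<omega>])
      then have "ennreal (?e (Suc k) \<omega> + (1 / \<eta> - Lc) * ?d \<omega>) \<le> ennreal (?e k \<omega> + 1 / (2 * Lc) * ?w \<omega>)"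
        by (rule ennreal_leI)
      moreover have "ennreal (?e (Suc k) \<omega> + (1 / \<eta> - Lc) * ?d \<omega>)
          = ennreal (?e (Suc k) \<omega>) + ennreal (1 / \<eta> - Lc) * ennreal (?d \<omega>)"
        using pos ge by (simp add: ennreal_plus ennreal_mult')
      moreover have "ennreal (?e k \<omega> + 1 / (2 * Lc) * ?w \<omega>)
          = ennreal (?e k \<omega>) + ennreal (1 / (2 * Lc)) * ennreal (?w \<omega>)"
        using ennreal_plus[OF ge(1) mult_nonneg_nonneg[OF pos(2) zero_le_power2]]
          ennreal_mult'[OF zero_le_power2] ennreal_mult[OF pos(2) zero_le_power2] by metis
      ultimately show ?thesis using True by simp
    qed simp
  qed
  also have "\<dots> = expected_energy N k + ennreal (1 / (2 * Lc)) * expected_sq_delay N k"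
    unfolding expected_energy_def expected_sq_delay_def
    by (subst nn_integral_add) (auto intro!: me mw borel_measurable_times_ennreal simp: nn_integral_cmult[OF mw])
  finally show ?thesis .
qed

text \<open>
  One factor \<open>t\<close> comes from Cauchy--Schwarz and one from the number of overlapping windows;
  this is why the second moment of the delay governs the stepsize.
\<close>
lemma sum_expected_sq_delay_le:
  "(\<Sum>k\<in>{N..<K}. expected_sq_delay N k) \<le> ennreal (Lr\<^sup>2 / real m * S) * (\<Sum>l<K. expected_sq_step N l)"
proof -
  let ?A = "\<Sum>l<K. expected_sq_step N l"
  have "(\<Sum>k\<in>{N..<K}. expected_sq_delay N k)
      \<le> (\<Sum>k\<in>{N..<K}. \<integral>\<^sup>+t. ennreal (Lr\<^sup>2 / real m * real t) * (\<Sum>l\<in>{k - t..<k}. expected_sq_step N l) \<partial>measure_pmf q)"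
    by (intro sum_mono expected_sq_delay_le) auto
  also have "\<dots> \<le> (\<Sum>k<K. \<integral>\<^sup>+t. ennreal (Lr\<^sup>2 / real m * real t) * (\<Sum>l\<in>{k - t..<k}. expected_sq_step N l) \<partial>measure_pmf q)"
    by (intro sum_mono2) auto
  also have "\<dots> = (\<integral>\<^sup>+t. ennreal (Lr\<^sup>2 / real m * real t) * (\<Sum>k<K. \<Sum>l\<in>{k - t..<k}. expected_sq_step N l) \<partial>measure_pmf q)"
    by (subst nn_integral_sum[symmetric]) (simp_all add: sum_distrib_left)
  also have "\<dots> \<le> (\<integral>\<^sup>+t. ennreal (Lr\<^sup>2 / real m * real t) * (of_nat t * ?A) \<partial>measure_pmf q)"
    by (intro nn_integral_mono mult_left_mono sum_windows_le) simp
  also have "\<dots> = (\<integral>\<^sup>+t. ennreal (Lr\<^sup>2 / real m) * ?A * ennreal ((real t)\<^sup>2) \<partial>measure_pmf q)"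
  proof (intro nn_integral_cong)
    fix t
    have "ennreal (Lr\<^sup>2 / real m * real t) * of_nat t = ennreal (Lr\<^sup>2 / real m) * ennreal ((real t)\<^sup>2)"
      by (simp add: ennreal_of_nat_eq_real_of_nat ennreal_mult[symmetric] power2_eq_square)
    then show "ennreal (Lr\<^sup>2 / real m * real t) * (of_nat t * ?A) = ennreal (Lr\<^sup>2 / real m) * ?A * ennreal ((real t)\<^sup>2)"
      by (metis mult.assoc mult.commute)
  qed
  also have "\<dots> = ennreal (Lr\<^sup>2 / real m) * ?A * ennreal S"
    unfolding S_eq by (subst nn_integral_cmult) (simp_all add: nn_integral_eq_integral[OF S_finite])
  also have "\<dots> = ennreal (Lr\<^sup>2 / real m * S) * ?A"
    by (subst ennreal_mult') (simp_all add: mult_ac)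
  finally show ?thesis .
qed

text \<open>
  The descent inequality is summed from \<open>N\<close> on, while the windows reach back to steps before
  \<open>N\<close>; those finitely many steps only enlarge the constant.
\<close>
lemma expected_sq_step_summable: "(\<Sum>k. expected_sq_step N (k + N)) < \<top>"
proof -
  define \<alpha> \<gamma> where "\<alpha> = 1 / \<eta> - Lc" and "\<gamma> = Lr\<^sup>2 * S / (2 * real m * Lc)"
  define a e where "a k = enn2real (expected_sq_step N k)" and "e k = enn2real (expected_energy N k)" for k
  have a: "expected_sq_step N k = ennreal (a k)" and a0: "0 \<le> a k" for k
    using expected_sq_step_finite[of N k] by (simp_all add: a_def)
  have e: "expected_energy N k = ennreal (e k)" and e0: "0 \<le> e k" for k
    using expected_energy_finite[of N k] by (simp_all add: e_def)
  have "0 \<le> S" unfolding S_eq by (rule Bochner_Integration.integral_nonneg) simp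
  then have \<gamma>0: "0 \<le> \<gamma>" and \<alpha>\<gamma>: "\<gamma> < \<alpha>" using Lc_pos stepsize by (simp_all add: \<gamma>_def \<alpha>_def)
  have tele: "expected_energy N K + ennreal \<alpha> * (\<Sum>k\<in>{N..<K}. expected_sq_step N k)
      \<le> expected_energy N N + ennreal (1 / (2 * Lc)) * (\<Sum>k\<in>{N..<K}. expected_sq_delay N k)" if "N \<le> K" for K
    using that
  proof (induction rule: dec_induct)
    case base show ?case by simp
  next
    case (step K)
    have "expected_energy N (Suc K) + ennreal \<alpha> * (\<Sum>k\<in>{N..<Suc K}. expected_sq_step N k)
        = (expected_energy N (Suc K) + ennreal \<alpha> * expected_sq_step N K) + ennreal \<alpha> * (\<Sum>k\<in>{N..<K}. expected_sq_step N k)"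
      using step.hyps by (simp add: distrib_left add_ac)
    also have "\<dots> \<le> (expected_energy N K + ennreal (1 / (2 * Lc)) * expected_sq_delay N K) + ennreal \<alpha> * (\<Sum>k\<in>{N..<K}. expected_sq_step N k)"
      unfolding \<alpha>_def by (intro add_right_mono expected_descent step.hyps)
    also have "\<dots> \<le> (expected_energy N N + ennreal (1 / (2 * Lc)) * (\<Sum>k\<in>{N..<K}. expected_sq_delay N k)) + ennreal (1 / (2 * Lc)) * expected_sq_delay N K"
      using add_right_mono[OF step.IH] by (simp add: add_ac)
    also have "\<dots> = expected_energy N N + ennreal (1 / (2 * Lc)) * (\<Sum>k\<in>{N..<Suc K}. expected_sq_delay N k)"
      using step.hyps by (simp add: distrib_left add_ac)
    finally show ?case .
  qed
  \<comment> \<open>The bound solves \<open>\<alpha> s \<le> e N + \<gamma> (a 0 + \<dots> + a (N - 1) + s)\<close> for \<open>s\<close>.\<close>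
  define C where "C = (e N + \<gamma> * (\<Sum>l<N. a l)) / (\<alpha> - \<gamma>)"
  have bound: "(\<Sum>k\<in>{N..<K}. a k) \<le> C" if "N \<le> K" for K
  proof -
    have "ennreal (\<alpha> * (\<Sum>k\<in>{N..<K}. a k)) = ennreal \<alpha> * (\<Sum>k\<in>{N..<K}. expected_sq_step N k)"
      unfolding a using \<gamma>0 \<alpha>\<gamma> by (simp add: sum_ennreal a0 ennreal_mult' sum_nonneg)
    also have "\<dots> \<le> expected_energy N K + ennreal \<alpha> * (\<Sum>k\<in>{N..<K}. expected_sq_step N k)" by simp
    also have "\<dots> \<le> expected_energy N N + ennreal (1 / (2 * Lc)) * (\<Sum>k\<in>{N..<K}. expected_sq_delay N k)"
      by (rule tele[OF that])
    also have "\<dots> \<le> expected_energy N N + ennreal (1 / (2 * Lc)) * (ennreal (Lr\<^sup>2 / real m * S) * (\<Sum>l<K. expected_sq_step N l))"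
      by (intro add_left_mono mult_left_mono sum_expected_sq_delay_le) simp
    also have "\<dots> = ennreal (e N) + ennreal \<gamma> * ennreal (\<Sum>l<K. a l)"
    proof -
      have "ennreal (1 / (2 * Lc)) * ennreal (Lr\<^sup>2 / real m * S) = ennreal \<gamma>"
        using Lc_pos by (simp add: ennreal_mult'[symmetric] \<gamma>_def field_simps)
      then show ?thesis unfolding a e by (simp add: sum_ennreal a0 mult.assoc[symmetric])
    qed
    also have "\<dots> = ennreal (e N + \<gamma> * (\<Sum>l<K. a l))"
      using e0 \<gamma>0 a0 by (simp add: ennreal_plus ennreal_mult sum_nonneg)
    finally have "\<alpha> * (\<Sum>k\<in>{N..<K}. a k) \<le> e N + \<gamma> * (\<Sum>l<K. a l)"
      using e0 \<gamma>0 a0 by (subst (asm) ennreal_le_iff) (auto intro!: add_nonneg_nonneg mult_nonneg_nonneg sum_nonneg)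
    moreover have "(\<Sum>l<K. a l) = (\<Sum>l<N. a l) + (\<Sum>k\<in>{N..<K}. a k)"
      using that by (simp add: lessThan_atLeast0 sum.atLeastLessThan_concat)
    ultimately have "(\<alpha> - \<gamma>) * (\<Sum>k\<in>{N..<K}. a k) \<le> e N + \<gamma> * (\<Sum>l<N. a l)"
      by (simp add: algebra_simps)
    then show ?thesis using \<alpha>\<gamma> by (simp add: C_def pos_le_divide_eq mult.commute)
  qed
  have "(\<Sum>k<n. expected_sq_step N (k + N)) \<le> ennreal C" for n
  proof -
    have "(\<Sum>k<n. expected_sq_step N (k + N)) = (\<Sum>k\<in>{N..<n + N}. expected_sq_step N k)"
      using sum.shift_bounds_nat_ivl[of "expected_sq_step N" 0 N n] by (simp add: lessThan_atLeast0)
    also have "\<dots> = ennreal (\<Sum>k\<in>{N..<n + N}. a k)" unfolding a by (simp add: sum_ennreal a0)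
    also have "\<dots> \<le> ennreal C" by (intro ennreal_leI bound) simp
    finally show ?thesis .
  qed
  then have "(\<Sum>k. expected_sq_step N (k + N)) \<le> ennreal C" by (intro suminf_le_const) auto
  then show ?thesis by (rule le_less_trans) simp
qed

section \<open>Criticality of limit points\<close>
lemma AE_step_tendsto_zero:
  "AE \<omega> in M. feasible (x N \<omega>) \<longrightarrow> (\<lambda>k. x (Suc k) \<omega> - x k \<omega>) \<longlonglongrightarrow> 0"
proof -
  have "AE \<omega> in M. feasible (x N \<omega>) \<longrightarrow> (\<lambda>k. (norm (x (Suc (k + N)) \<omega> - x (k + N) \<omega>))\<^sup>2) \<longlonglongrightarrow> 0"
  proof (rule AE_tendsto_zero_if_sum_finite)
    show "(\<lambda>\<omega>. of_bool (feasible (x N \<omega>)) * ennreal ((norm (x (Suc (k + N)) \<omega> - x (k + N) \<omega>))\<^sup>2)) \<in> borel_measurable M" for k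
      using measurable_x_fun[of N "\<lambda>u v. (norm (v - u))\<^sup>2" "k + N" "Suc (k + N)"] .
    show "(\<Sum>k. \<integral>\<^sup>+\<omega>. of_bool (feasible (x N \<omega>)) * ennreal ((norm (x (Suc (k + N)) \<omega> - x (k + N) \<omega>))\<^sup>2) \<partial>M) < \<top>"
      using expected_sq_step_summable[of N] unfolding expected_sq_step_def .
  qed simp
  then show ?thesis
  proof eventually_elim
    case (elim \<omega>)
    show ?case
    proof
      assume "feasible (x N \<omega>)"
      with elim have "(\<lambda>k. 1 * (norm (x (Suc (k + N)) \<omega> - x (k + N) \<omega>))\<^sup>2) \<longlonglongrightarrow> 0" by simp
      then have "(\<lambda>k. x (Suc (k + N)) \<omega> - x (k + N) \<omega>) \<longlonglongrightarrow> 0"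
        by (rule tendsto_zero_if_norm_square) simp
      then show "(\<lambda>k. x (Suc k) \<omega> - x k \<omega>) \<longlonglongrightarrow> 0" by (rule LIMSEQ_offset)
    qed
  qed
qed

text \<open>
  The expected squared step averages the squared candidate steps over all blocks and delays, so
  it dominates the single candidate \<open>(a, t)\<close> with weight \<open>pmf q t / m\<close>.
\<close>
lemma AE_candidate_tendsto_zero:
  assumes a: "a \<in> {1..m}" and t: "0 < pmf q t"
  shows "AE \<omega> in M. feasible (x N \<omega>) \<longrightarrow> (\<lambda>k. incr a (x k \<omega>) (x (k - t) \<omega>)) \<longlonglongrightarrow> 0"
proof -
  define \<beta> where "\<beta> = pmf q t * (1 / real m)"
  have \<beta>: "0 < \<beta>" using t m_pos by (simp add: \<beta>_def)
  let ?ind = "\<lambda>\<omega>. of_bool (feasible (x N \<omega>)) :: ennreal"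
  have meas: "(\<lambda>\<omega>. ?ind \<omega> * ennreal (g (x k \<omega>) (x (k - t) \<omega>))) \<in> borel_measurable M" for g k
    by (rule measurable_x_fun)
  have le: "(\<integral>\<^sup>+\<omega>. ?ind \<omega> * ennreal (\<beta> * (norm (incr a (x k \<omega>) (x (k - t) \<omega>)))\<^sup>2) \<partial>M) \<le> expected_sq_step N k"
    if "N \<le> k" for k
  proof -
    let ?g = "\<lambda>b u w. (norm (incr b u w))\<^sup>2"
    let ?I = "\<lambda>t. \<integral>\<^sup>+\<omega>. ennreal (1 / real m) * (\<Sum>b=1..m. ?ind \<omega> * ennreal (?g b (x k \<omega>) (x (k - t) \<omega>))) \<partial>M"
    have "(\<integral>\<^sup>+\<omega>. ?ind \<omega> * ennreal (\<beta> * ?g a (x k \<omega>) (x (k - t) \<omega>)) \<partial>M)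
        = ennreal (pmf q t) * (\<integral>\<^sup>+\<omega>. ennreal (1 / real m) * (?ind \<omega> * ennreal (?g a (x k \<omega>) (x (k - t) \<omega>))) \<partial>M)"
    proof -
      have "(\<lambda>\<omega>. ennreal (1 / real m) * (?ind \<omega> * ennreal (?g a (x k \<omega>) (x (k - t) \<omega>)))) \<in> borel_measurable M"
        by (intro borel_measurable_times_ennreal borel_measurable_const meas)
      note nn_integral_cmult[OF this, symmetric]
      moreover have "?ind \<omega> * ennreal (\<beta> * ?g a (x k \<omega>) (x (k - t) \<omega>))
          = ennreal (pmf q t) * (ennreal (1 / real m) * (?ind \<omega> * ennreal (?g a (x k \<omega>) (x (k - t) \<omega>))))" for \<omega>
      proof -
        have "ennreal (\<beta> * z) = ennreal (pmf q t) * (ennreal (1 / real m) * ennreal z)" if "0 \<le> z" for z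
          using that by (simp add: \<beta>_def ennreal_mult'[symmetric])
        from this[of "?g a (x k \<omega>) (x (k - t) \<omega>)"] show ?thesis
          by (cases "feasible (x N \<omega>)") simp_all
      qed
      ultimately show ?thesis by simp
    qed
    also have "\<dots> \<le> ennreal (pmf q t) * ?I t"
    proof (intro mult_left_mono nn_integral_mono)
      fix \<omega>
      show "?ind \<omega> * ennreal (?g a (x k \<omega>) (x (k - t) \<omega>)) \<le> (\<Sum>b=1..m. ?ind \<omega> * ennreal (?g b (x k \<omega>) (x (k - t) \<omega>)))"
        using a by (intro member_le_sum) auto
    qed simp_all
    also have "\<dots> \<le> (\<integral>\<^sup>+t. ?I t \<partial>measure_pmf q)" by (rule nn_integral_pmf_ge_point)
    also have "\<dots> = (\<integral>\<^sup>+\<omega>. ?ind \<omega> * ennreal (?g (i k \<omega>) (x k \<omega>) (x (k - j k \<omega>) \<omega>)) \<partial>M)"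
      by (rule nn_integral_next_sample_x[OF that, where g = ?g, symmetric])
    also have "\<dots> = expected_sq_step N k"
      unfolding expected_sq_step_def by (intro nn_integral_cong) (simp add: x_Suc)
    finally show ?thesis .
  qed
  have "AE \<omega> in M. feasible (x N \<omega>) \<longrightarrow>
      (\<lambda>k. \<beta> * (norm (incr a (x (k + N) \<omega>) (x (k + N - t) \<omega>)))\<^sup>2) \<longlonglongrightarrow> 0"
  proof (rule AE_tendsto_zero_if_sum_finite)
    show "(\<lambda>\<omega>. ?ind \<omega> * ennreal (\<beta> * (norm (incr a (x (k + N) \<omega>) (x (k + N - t) \<omega>)))\<^sup>2)) \<in> borel_measurable M" for k
      by (rule meas)
    have "(\<Sum>k. \<integral>\<^sup>+\<omega>. ?ind \<omega> * ennreal (\<beta> * (norm (incr a (x (k + N) \<omega>) (x (k + N - t) \<omega>)))\<^sup>2) \<partial>M)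
        \<le> (\<Sum>k. expected_sq_step N (k + N))"
      by (intro suminf_le le) auto
    also have "\<dots> < \<top>" by (rule expected_sq_step_summable)
    finally show "(\<Sum>k. \<integral>\<^sup>+\<omega>. ?ind \<omega> * ennreal (\<beta> * (norm (incr a (x (k + N) \<omega>) (x (k + N - t) \<omega>)))\<^sup>2) \<partial>M) < \<top>" .
  qed (use \<beta> in simp)
  then show ?thesis
  proof eventually_elim
    case (elim \<omega>)
    show ?case
    proof
      assume "feasible (x N \<omega>)"
      with elim have "(\<lambda>k. \<beta> * (norm (incr a (x (k + N) \<omega>) (x (k + N - t) \<omega>)))\<^sup>2) \<longlonglongrightarrow> 0"
        by simp
      then have "(\<lambda>k. incr a (x (k + N) \<omega>) (x (k + N - t) \<omega>)) \<longlonglongrightarrow> 0"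
        by (rule tendsto_zero_if_norm_square[OF _ \<beta>])
      then show "(\<lambda>k. incr a (x k \<omega>) (x (k - t) \<omega>)) \<longlonglongrightarrow> 0" by (rule LIMSEQ_offset)
    qed
  qed
qed

text \<open>
  A single delay \<open>t\<close> of positive probability suffices.  The point where the gradient is read is
  then \<open>x (k - t)\<close>, at a fixed distance in time from \<open>x k\<close>, and shares its limit points because
  the steps vanish.
\<close>
lemma AE_limit_points_critical:
  "AE \<omega> in M. \<forall>xs. (\<exists>s. strict_mono s \<and> (\<lambda>k. x (s k) \<omega>) \<longlonglongrightarrow> xs) \<longrightarrow>
     0 \<in> (\<lambda>g. grad f xs + g) ` subdifferential (block_sum B m r) xs"
proof -
  obtain t where "t \<in> set_pmf q" using set_pmf_not_empty[of q] by blast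
  then have t: "0 < pmf q t" by (rule pmf_positive)
  have step0: "AE \<omega> in M. \<forall>N. feasible (x N \<omega>) \<longrightarrow> (\<lambda>k. x (Suc k) \<omega> - x k \<omega>) \<longlonglongrightarrow> 0"
    unfolding AE_all_countable by (intro allI AE_step_tendsto_zero)
  have cand0: "AE \<omega> in M. \<forall>a\<in>{1..m}. \<forall>N. feasible (x N \<omega>) \<longrightarrow> (\<lambda>k. incr a (x k \<omega>) (x (k - t) \<omega>)) \<longlonglongrightarrow> 0"
  proof (intro AE_ball_countable' countable_finite)
    fix a assume "a \<in> {1..m}"
    then show "AE \<omega> in M. \<forall>N. feasible (x N \<omega>) \<longrightarrow> (\<lambda>k. incr a (x k \<omega>) (x (k - t) \<omega>)) \<longlonglongrightarrow> 0"
      unfolding AE_all_countable by (intro allI AE_candidate_tendsto_zero t)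
  qed simp
  show ?thesis
    using AE_eventually_feasible step0 cand0
  proof eventually_elim
    case (elim \<omega>)
    then obtain N where "feasible (x N \<omega>)" by blast
    then have d: "(\<lambda>k. x (Suc k) \<omega> - x k \<omega>) \<longlonglongrightarrow> 0"
      and cand: "\<And>a. a \<in> {1..m} \<Longrightarrow> (\<lambda>k. incr a (x k \<omega>) (x (k - t) \<omega>)) \<longlonglongrightarrow> 0"
      using elim by blast+
    show ?case
    proof (intro allI impI, elim exE conjE)
      fix xs s assume s: "strict_mono s" and lim: "(\<lambda>k. x (s k) \<omega>) \<longlonglongrightarrow> xs"
      have "(\<lambda>n. x (s n) \<omega> - x (s n - t) \<omega>) \<longlonglongrightarrow> 0"
        using LIMSEQ_subseq_LIMSEQ[OF delayed_difference_tendsto_zero[where X = "\<lambda>k. x k \<omega>", OF d, of t] s]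
        by (simp add: o_def)
      from tendsto_diff[OF lim this] have lim': "(\<lambda>n. x (s n - t) \<omega>) \<longlonglongrightarrow> xs" by simp
      show "0 \<in> (\<lambda>g. grad f xs + g) ` subdifferential (block_sum B m r) xs"
      proof (rule limit_is_critical[OF lim lim'])
        fix a assume "a \<in> {1..m}"
        from LIMSEQ_subseq_LIMSEQ[OF cand[OF this] s]
        show "(\<lambda>n. incr a (x (s n) \<omega>) (x (s n - t) \<omega>)) \<longlonglongrightarrow> 0" by (simp add: o_def)
      qed
    qed
  qed
qed

end

theorem theorem5:
  fixes B :: "nat \<Rightarrow> 'n::finite set"
    and m :: nat
    and f :: "real ^ 'n \<Rightarrow> real"
    and r :: "nat \<Rightarrow> real ^ 'n \<Rightarrow> ereal"
    and R F :: "real ^ 'n \<Rightarrow> ereal"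
    and Lf Lr Lc \<kappa> \<eta> S :: real
    and M :: "'w measure"
    and i j :: "nat \<Rightarrow> 'w \<Rightarrow> nat"
    and q :: "nat pmf"
    and x0 :: "real ^ 'n"
    and x :: "nat \<Rightarrow> 'w \<Rightarrow> real ^ 'n"
  assumes blocks: "block_partition B m"
    and f_diff: "\<And>y. f differentiable (at y)"
    and Lc_pos: "0 < Lc"
    and f_lip: "block_lipschitz B m f Lf Lr Lc"
    and r_pcc: "\<And>l. l \<in> {1..m} \<Longrightarrow> proper_closed_convex_on (block_space B l) (r l)"
    and R_eq: "R = block_sum B m r"
    and F_eq: "F = (\<lambda>y. ereal (f y) + R y)"
    and F_bdd_below: "\<exists>c::real. \<forall>y. ereal c \<le> F y"
    and F_minimizer: "\<exists>z. \<forall>y. F z \<le> F y"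
    and M_prob: "prob_space M"
    and i_unif: "\<And>k. distr M (count_space {1..m}) (i k) = uniform_count_measure {1..m}"
    and j_dist: "\<And>k. distr M (count_space UNIV) (j k) = measure_pmf q"
    and ij_indep: "\<And>k. indep_rv M (count_space {1..m}) (i k) (count_space UNIV) (j k)"
    and hist_indep: "\<And>k. indep_rv M
          (count_space {1..m} \<Otimes>\<^sub>M count_space UNIV) (\<lambda>\<omega>. (i k \<omega>, j k \<omega>))
          (\<Pi>\<^sub>M l\<in>{..<k}. count_space {1..m} \<Otimes>\<^sub>M count_space UNIV)
          (\<lambda>\<omega>. \<lambda>l\<in>{..<k}. (i l \<omega>, j l \<omega>))"
    and x_alg: "\<And>\<omega>. \<omega> \<in> space M \<Longrightarrow>
          async_bcu B m f r \<eta> x0 (\<lambda>k. i k \<omega>) (\<lambda>k. j k \<omega>) (\<lambda>k. x k \<omega>)"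
    and S_finite: "integrable (measure_pmf q) (\<lambda>t. (real t)\<^sup>2)"
    and S_eq: "S = measure_pmf.expectation q (\<lambda>t. (real t)\<^sup>2)"
    and \<kappa>_eq: "\<kappa> = Lr / Lc"
    and \<eta>_pos: "0 < \<eta>"
    and \<eta>_less: "\<eta> < (1 / Lc) / (1 + \<kappa>\<^sup>2 * S / (2 * real m))"
  shows "AE \<omega> in M. \<forall>xs. (\<exists>s. strict_mono s \<and> (\<lambda>k. x (s k) \<omega>) \<longlonglongrightarrow> xs) \<longrightarrow>
           0 \<in> (\<lambda>g. grad f xs + g) ` subdifferential R xs"
proof -
  obtain c where c: "\<And>y. ereal c \<le> F y" using F_bdd_below by blast
  interpret prob_space M by (rule M_prob)
  have m: "0 < m" by (rule block_partition_pos[OF blocks])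
  have "0 \<le> S" unfolding S_eq by (rule Bochner_Integration.integral_nonneg) simp
  then have pos: "0 < 1 + \<kappa>\<^sup>2 * S / (2 * real m)"
    by (intro add_pos_nonneg divide_nonneg_nonneg mult_nonneg_nonneg) auto
  have "Lc * D < 1 / \<eta>" if "\<eta> < (1 / Lc) / D" "0 < D" for D
    using that \<eta>_pos Lc_pos by (simp add: field_simps)
  from this[OF \<eta>_less pos] have "Lc * (1 + \<kappa>\<^sup>2 * S / (2 * real m)) < 1 / \<eta>" .
  moreover have "Lc * (1 + \<kappa>\<^sup>2 * S / (2 * real m)) = Lc + Lr\<^sup>2 * S / (2 * real m * Lc)"
    unfolding \<kappa>_eq using Lc_pos m by (simp add: field_simps power2_eq_square)
  ultimately have stepsize: "Lr\<^sup>2 * S / (2 * real m * Lc) < 1 / \<eta> - Lc" by simp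
  interpret async_process B m f r Lf Lr Lc \<eta> M i j q x0 x S c
    by unfold_locales
      (use assms m c stepsize in \<open>simp_all add: F_eq R_eq del: One_nat_def\<close>)
  show ?thesis unfolding R_eq by (rule AE_limit_points_critical)
qed

end
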